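(* Let $M,N\ge1$, $n=n_1+\dots+n_M$, $m=m_1+\dots+m_M$, $A\in\mathbb R^{n\times n}$, $B=\mathrm{diag}(B_1,\dots,B_M)\in\mathbb R^{n\times m}$ with $B_i\in\mathbb R^{n_i\times m_i}$, and let $Q_f,Q,W_f,W\in\mathbb S^n$, $R\in\mathbb S^m$ satisfy $Q_f\succeq0$, $Q\succeq0$, $R\succ0$, $W_f\succ0$, $W\succ0$. Let $J_{\mathcal K}^*$ be the optimal value of the decentralized LQG problem, let $(S_k^*,L_k^*,G_k^* )_{k=0}^{N-1}$ be an optimal point of the convex relaxation, and let $\tilde J_{\mathcal K}^*$ be the corresponding optimal objective function value (all defined in the context). Then $$J_{\mathcal K}^*\le\tilde J_{\mathcal K}^*$$ is satisfied under the decentralized control policy $$u_i(k)=(L_{k,i}^* )^T(G_{k,i}^* )^{-T}x_i(k)\qquad\text{for all } k\in\{0,1,\dots,N-1\},\ i\in\{1,2,\dots,M\}.$$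
   Context: $\mathbb S^r$ denotes the real symmetric $r\times r$ matrices; $\succeq,\succ$ are the (strict) semidefinite orders; $\mathrm{diag}$ of blocks denotes a block-diagonal matrix; $*$ inside a symmetric block matrix denotes the transpose of the symmetric entry; $X^{-T}$ is the transpose of the inverse of $X$. Decentralized LQG problem. Consider $x(k+1)=Ax(k)+Bu(k)+w(k)$ with state $x(k)=(x_1(k),\dots,x_M(k))$, $x_i(k)\in\mathbb R^{n_i}$, and input $u(k)=(u_1(k),\dots,u_M(k))$, $u_i(k)\in\mathbb R^{m_i}$, where $x(0)\sim\mathcal N(0,W_f)$ and $w(k)\sim\mathcal N(0,W)$, $k\ge 0$, are mutually independent Gaussian vectors. Let $\mathcal K:=\{\mathrm{diag}(K_1,\dots,K_M): K_i\in\mathbb R^{m_i\times n_i}\}\subset\mathbb R^{m\times n}$. Then $J_{\mathcal K}^*$ is the minimum, over $F_0,\dots,F_{N-1}\in\mathcal K$ with $u(k)=F_kx(k)$, of $$\mathbb E\big(x(N)^TQ_fx(N)\big)+\sum_{k=0}^{N-1}\mathbb E\left(\begin{bmatrix}x(k) \\ u(k)\end{bmatrix}^T\begin{bmatrix}Q&0 \\ 0&R\end{bmatrix}\begin{bmatrix}x(k) \\ u(k)\end{bmatrix}\right).$$ Convex relaxation. Minimize $$J_p(\{S_k\}_{k=0}^{N-1}):=\mathrm{Tr}\left(Q_f\left(\begin{bmatrix}A & B\end{bmatrix}S_{N-1}\begin{bmatrix}A & B\end{bmatrix}^T+W\right)\right)+\sum_{k=0}^{N-1}\mathrm{Tr}\left(\begin{bmatrix}Q&0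 \\ 0&R\end{bmatrix}S_k\right)$$ over $S_k\in\mathbb S^{n+m}$, $L_k=\mathrm{diag}(L_{k,1},\dots,L_{k,M})\in\mathbb R^{n\times m}$ with $L_{k,i}\in\mathbb R^{n_i\times m_i}$, and $G_k=\mathrm{diag}(G_{k,1},\dots,G_{k,M})\in\mathbb R^{n\times n}$ with $G_{k,i}\in\mathbb R^{n_i\times n_i}$ ($k=0,\dots,N-1$), subject to $$\begin{bmatrix}S_k & * \\ \begin{bmatrix}G_k & L_k\end{bmatrix} & G_k+G_k^T-\begin{bmatrix}A & B\end{bmatrix}S_{k-1}\begin{bmatrix}A & B\end{bmatrix}^T-W\end{bmatrix}\succeq0\quad(k=1,\dots,N-1),$$ $$\begin{bmatrix}S_0 & * \\ \begin{bmatrix}G_0 & L_0\end{bmatrix} & G_0+G_0^T-W_f\end{bmatrix}\succeq0 .$$ The blocks of the optimal point are written $L_k^*=\mathrm{diag}(L_{k,1}^*,\dots,L_{k,M}^* )$ and $G_k^*=\mathrm{diag}(G_{k,1}^*,\dots,G_{k,M}^* )$. *)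

theory Defs
  imports
    "HOL-Probability.Probability"
    "Jordan_Normal_Form.Gauss_Jordan_Elimination"
begin

(* The infixes of inner and vec_nth coincide with those of scalar_prod and vec_index. *)
unbundle no inner_syntax
unbundle no vec_syntax

section \<open>Matrices\<close>

definition mat_trace :: "real mat \<Rightarrow> real" where
  "mat_trace A = (\<Sum>i<dim_row A. A $$ (i, i))"

definition psd :: "nat \<Rightarrow> real mat \<Rightarrow> bool" where
  "psd d X \<longleftrightarrow> X \<in> carrier_mat d d \<and> X\<^sup>T = X \<and> (\<forall>v \<in> carrier_vec d. 0 \<le> v \<bullet> (X *\<^sub>v v))"

definition pos_def :: "nat \<Rightarrow> real mat \<Rightarrow> bool" where
  "pos_def d X \<longleftrightarrow> X \<in> carrier_mat d d \<and> X\<^sup>T = X \<and>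
     (\<forall>v \<in> carrier_vec d. v \<noteq> 0\<^sub>v d \<longrightarrow> 0 < v \<bullet> (X *\<^sub>v v))"

text \<open>The column-wise counterpart \<open>[A B]\<close> of \<^const>\<open>append_rows\<close>.\<close>

definition append_columns :: "real mat \<Rightarrow> real mat \<Rightarrow> real mat" where
  "append_columns A B = four_block_mat A B (0\<^sub>m 0 (dim_col A)) (0\<^sub>m 0 (dim_col B))"

text \<open>Blocks are numbered from 0, so \<open>blkdiag M X\<close> is \<open>diag(X 0, \<dots>, X (M - 1))\<close>.\<close>

definition blkdiag :: "nat \<Rightarrow> (nat \<Rightarrow> real mat) \<Rightarrow> real mat" where
  "blkdiag M X = diag_block_mat (map X [0..<M])"

text \<open>The \<open>i\<close>-th subvector of \<open>v\<close> when \<open>v\<close> is cut into pieces of sizes \<open>ds 0, ds 1, \<dots>\<close>.\<close>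

definition vec_block :: "(nat \<Rightarrow> nat) \<Rightarrow> nat \<Rightarrow> real vec \<Rightarrow> real vec" where
  "vec_block ds i v = vec (ds i) (\<lambda>j. v $ ((\<Sum>l<i. ds l) + j))"

text \<open>Meaningful for invertible matrices only.\<close>

definition mat_inv :: "real mat \<Rightarrow> real mat" where
  "mat_inv A = the (mat_inverse A)"

section \<open>Gaussian random vectors\<close>

text \<open>The Borel sigma-algebra on the vectors of dimension \<open>d\<close>, transported from the product
  space of their coordinates.\<close>

definition vec_borel :: "nat \<Rightarrow> real vec measure" where
  "vec_borel d = vimage_algebra (carrier_vec d) (\<lambda>v. \<lambda>i\<in>{..<d}. v $ i) (\<Pi>\<^sub>M i\<in>{..<d}. borel)"

text \<open>A random vector is \<open>\<N>(\<mu>, \<Sigma>)\<close>-distributed if every linear functional \<open>a\<close> of it is normal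
  with mean \<open>a \<bullet> \<mu>\<close> and variance \<open>a \<bullet> \<Sigma>a\<close>; variance 0 means almost surely constant.\<close>

definition gaussian_vec ::
  "'a measure \<Rightarrow> nat \<Rightarrow> ('a \<Rightarrow> real vec) \<Rightarrow> real vec \<Rightarrow> real mat \<Rightarrow> bool" where
  "gaussian_vec P d X \<mu> V \<longleftrightarrow>
     X \<in> measurable P (vec_borel d) \<and> \<mu> \<in> carrier_vec d \<and> psd d V \<and>
     (\<forall>a \<in> carrier_vec d. let v = a \<bullet> (V *\<^sub>v a) in
        if v = 0 then (AE \<omega> in P. a \<bullet> X \<omega> = a \<bullet> \<mu>)
        else distributed P lborel (\<lambda>\<omega>. a \<bullet> X \<omega>) (normal_density (a \<bullet> \<mu>) (sqrt v)))"

section \<open>The decentralized LQG problem\<close>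

text \<open>\<open>x0\<close> and \<open>w k\<close> are the random initial state and disturbances.\<close>

definition lqg_noise ::
  "'a measure \<Rightarrow> nat \<Rightarrow> real mat \<Rightarrow> real mat \<Rightarrow> ('a \<Rightarrow> real vec) \<Rightarrow> (nat \<Rightarrow> 'a \<Rightarrow> real vec) \<Rightarrow> bool"
where
  "lqg_noise P n Wf W x0 w \<longleftrightarrow>
     prob_space P \<and>
     gaussian_vec P n x0 (0\<^sub>v n) Wf \<and>
     (\<forall>k. gaussian_vec P n (w k) (0\<^sub>v n) W) \<and>
     prob_space.indep_vars P (\<lambda>_. vec_borel n) (\<lambda>j. case j of 0 \<Rightarrow> x0 | Suc k \<Rightarrow> w k) UNIV"

definition lqg_dynamics ::
  "'a measure \<Rightarrow> nat \<Rightarrow> nat \<Rightarrow> real mat \<Rightarrow> real mat \<Rightarrow>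
   ('a \<Rightarrow> real vec) \<Rightarrow> (nat \<Rightarrow> 'a \<Rightarrow> real vec) \<Rightarrow>
   (nat \<Rightarrow> 'a \<Rightarrow> real vec) \<Rightarrow> (nat \<Rightarrow> 'a \<Rightarrow> real vec) \<Rightarrow> bool" where
  "lqg_dynamics P m N A B x0 w x u \<longleftrightarrow>
     (\<forall>\<omega> \<in> space P. x 0 \<omega> = x0 \<omega> \<and>
        (\<forall>k<N. u k \<omega> \<in> carrier_vec m \<and>
               x (Suc k) \<omega> = A *\<^sub>v x k \<omega> + B *\<^sub>v u k \<omega> + w k \<omega>))"

definition stage_weight :: "nat \<Rightarrow> nat \<Rightarrow> real mat \<Rightarrow> real mat \<Rightarrow> real mat" where
  "stage_weight n m Q R = four_block_mat Q (0\<^sub>m n m) (0\<^sub>m m n) R"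

definition lqg_cost ::
  "'a measure \<Rightarrow> nat \<Rightarrow> nat \<Rightarrow> nat \<Rightarrow> real mat \<Rightarrow> real mat \<Rightarrow> real mat \<Rightarrow>
   (nat \<Rightarrow> 'a \<Rightarrow> real vec) \<Rightarrow> (nat \<Rightarrow> 'a \<Rightarrow> real vec) \<Rightarrow> real" where
  "lqg_cost P n m N Qf Q R x u =
     prob_space.expectation P (\<lambda>\<omega>. x N \<omega> \<bullet> (Qf *\<^sub>v x N \<omega>)) +
     (\<Sum>k<N. prob_space.expectation P
        (\<lambda>\<omega>. (x k \<omega> @\<^sub>v u k \<omega>) \<bullet> (stage_weight n m Q R *\<^sub>v (x k \<omega> @\<^sub>v u k \<omega>))))"

definition decentralized_gains :: "nat \<Rightarrow> (nat \<Rightarrow> nat) \<Rightarrow> (nat \<Rightarrow> nat) \<Rightarrow> real mat set" where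
  "decentralized_gains M ns ms =
     {blkdiag M K | K. \<forall>i<M. K i \<in> carrier_mat (ms i) (ns i)}"

text \<open>The optimal value is written as an infimum. The set of attainable costs is nonempty and, for
  positive semidefinite weights, bounded below by 0, so this is the genuine infimum; it is the
  minimum whenever the latter exists.\<close>

definition lqg_value ::
  "'a measure \<Rightarrow> nat \<Rightarrow> (nat \<Rightarrow> nat) \<Rightarrow> (nat \<Rightarrow> nat) \<Rightarrow> nat \<Rightarrow> real mat \<Rightarrow> real mat \<Rightarrow>
   real mat \<Rightarrow> real mat \<Rightarrow> real mat \<Rightarrow> ('a \<Rightarrow> real vec) \<Rightarrow> (nat \<Rightarrow> 'a \<Rightarrow> real vec) \<Rightarrow> real" where
  "lqg_value P M ns ms N A B Qf Q R x0 w =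
     Inf {lqg_cost P (\<Sum>i<M. ns i) (\<Sum>i<M. ms i) N Qf Q R x u | x u F.
            lqg_dynamics P (\<Sum>i<M. ms i) N A B x0 w x u \<and>
            (\<forall>k<N. F k \<in> decentralized_gains M ns ms \<and>
                   (\<forall>\<omega> \<in> space P. u k \<omega> = F k *\<^sub>v x k \<omega>))}"

section \<open>The convex relaxation\<close>

definition relax_cost ::
  "nat \<Rightarrow> nat \<Rightarrow> nat \<Rightarrow> real mat \<Rightarrow> real mat \<Rightarrow> real mat \<Rightarrow> real mat \<Rightarrow> real mat \<Rightarrow> real mat \<Rightarrow>
   (nat \<Rightarrow> real mat) \<Rightarrow> real" where
  "relax_cost n m N A B Qf Q R W S =
     mat_trace (Qf * (append_columns A B * S (N - 1) * (append_columns A B)\<^sup>T + W)) +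
     (\<Sum>k<N. mat_trace (stage_weight n m Q R * S k))"

text \<open>\<open>V\<close> is the matrix subtracted from \<open>G + G\<^sup>T\<close> in the lower right block.\<close>

definition relax_lmi :: "nat \<Rightarrow> nat \<Rightarrow> real mat \<Rightarrow> real mat \<Rightarrow> real mat \<Rightarrow> real mat \<Rightarrow> bool" where
  "relax_lmi n m S G L V \<longleftrightarrow>
     psd (n + m + n)
       (four_block_mat S ((append_columns G L)\<^sup>T) (append_columns G L) (G + G\<^sup>T - V))"

definition relax_feasible ::
  "nat \<Rightarrow> (nat \<Rightarrow> nat) \<Rightarrow> (nat \<Rightarrow> nat) \<Rightarrow> nat \<Rightarrow> real mat \<Rightarrow> real mat \<Rightarrow> real mat \<Rightarrow> real mat \<Rightarrow>
   (nat \<Rightarrow> real mat) \<Rightarrow> (nat \<Rightarrow> nat \<Rightarrow> real mat) \<Rightarrow> (nat \<Rightarrow> nat \<Rightarrow> real mat) \<Rightarrow> bool" where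
  "relax_feasible M ns ms N A B Wf W S L G \<longleftrightarrow>
     (let n = \<Sum>i<M. ns i; m = \<Sum>i<M. ms i; AB = append_columns A B in
       (\<forall>k<N. S k \<in> carrier_mat (n + m) (n + m) \<and> (S k)\<^sup>T = S k \<and>
          (\<forall>i<M. L k i \<in> carrier_mat (ns i) (ms i) \<and> G k i \<in> carrier_mat (ns i) (ns i))) \<and>
       (\<forall>k \<in> {1..<N}. relax_lmi n m (S k) (blkdiag M (G k)) (blkdiag M (L k))
          (AB * S (k - 1) * AB\<^sup>T + W)) \<and>
       relax_lmi n m (S 0) (blkdiag M (G 0)) (blkdiag M (L 0)) Wf)"

definition relax_optimal ::
  "nat \<Rightarrow> (nat \<Rightarrow> nat) \<Rightarrow> (nat \<Rightarrow> nat) \<Rightarrow> nat \<Rightarrow> real mat \<Rightarrow> real mat \<Rightarrow>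
   real mat \<Rightarrow> real mat \<Rightarrow> real mat \<Rightarrow> real mat \<Rightarrow> real mat \<Rightarrow>
   (nat \<Rightarrow> real mat) \<Rightarrow> (nat \<Rightarrow> nat \<Rightarrow> real mat) \<Rightarrow> (nat \<Rightarrow> nat \<Rightarrow> real mat) \<Rightarrow> bool" where
  "relax_optimal M ns ms N A B Qf Q R Wf W S L G \<longleftrightarrow>
     relax_feasible M ns ms N A B Wf W S L G \<and>
     (\<forall>S' L' G'. relax_feasible M ns ms N A B Wf W S' L' G' \<longrightarrow>
        relax_cost (\<Sum>i<M. ns i) (\<Sum>i<M. ms i) N A B Qf Q R W S
          \<le> relax_cost (\<Sum>i<M. ns i) (\<Sum>i<M. ms i) N A B Qf Q R W S')"

end

theory Submission
  imports Defs "Jordan_Normal_Form.Determinant"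
begin

text \<open>Let \<open>V\<^sub>0 = W\<^sub>f\<close> and \<open>V\<^sub>k = [A B] S\<^sub>k\<^sub>-\<^sub>1 [A B]\<^sup>T + W\<close> be the matrices subtracted in the linear matrix
  inequalities, and put \<open>F = L\<^sup>T G\<^sup>-\<^sup>T\<close>. Each inequality forces \<open>G + G\<^sup>T \<succeq> V\<^sub>k \<succ> 0\<close>, so that \<open>G\<close> is
  invertible, and \<open>S\<^sub>k \<succeq> [I; F] V\<^sub>k [I; F]\<^sup>T\<close>. Hence, by induction on \<open>k\<close>, the covariance of the
  closed-loop state \<open>x(k)\<close> is at most \<open>V\<^sub>k\<close> and that of \<open>(x(k), u(k))\<close> at most \<open>S\<^sub>k\<close>. The weights
  are sums of rank one matrices \<open>c c\<^sup>T\<close>, so it suffices to follow the second moments of the linear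
  functionals \<open>c \<bullet> x(k)\<close>.\<close>

section \<open>Positive semidefinite matrices\<close>

text \<open>The slack matrix \<open>G\<close> is what makes the gain decentralized. Recovering a
  gain with the inverse of the covariance bound itself would destroy the block structure, because
  that bound couples all agents; with \<open>G\<close> and \<open>L\<close> block diagonal,
  \<open>F\<close> is block diagonal. The price is that \<open>G\<close> is neither symmetric nor
  tied to V_k. The usual way to eliminate it is G V^-1 G^T >= G + G^T - V, that is (G - V) V^-1 (G -
  V)^T >= 0, combined with a Schur complement. Here each matrix inequality is instead read as a
  quadratic form and evaluated at well chosen vectors, so neither an inverse of V_k nor a Schur
  complement of the inequality occurs. No covariance matrix of x(k) is formed either. Gaussian
  vectors are defined through linear functionals, and the dynamics send the functional c of x(k+1)
  to the functional (A + B F)^T c of x(k) plus noise. Statements about all c are therefore closed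
  under the recursion, which is why the inductions along time generalise over c.\<close>

lemma psd_kernel_decomposition:
  fixes q :: "nat \<Rightarrow> nat \<Rightarrow> real"
  assumes "\<And>i j. i < d \<Longrightarrow> j < d \<Longrightarrow> q i j = q j i"
    and "\<And>v :: nat \<Rightarrow> real. 0 \<le> (\<Sum>i<d. \<Sum>j<d. v i * q i j * v j)"
  shows "\<exists>c. \<forall>i<d. \<forall>j<d. q i j = (\<Sum>l<d. c l i * c l j)"
  using assms
proof (induction d arbitrary: q)
  case 0
  then show ?case by simp
next
  case (Suc d)
  note sym = Suc.prems(1) and nonneg = Suc.prems(2)
  \<comment> \<open>Induction by completing the square in the last coordinate: \<open>a\<close> is
    the last diagonal entry, \<open>s v\<close> the linear coefficient, and \<open>q'\<close> below
    is the Schur complement of \<open>a\<close>. Working with functions on indices lets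
    \<open>q'\<close> keep the indexing of \<open>q\<close>.\<close>
  define a where "a = q d d"
  define s where "s v = (\<Sum>j<d. v j * q j d)" for v :: "nat \<Rightarrow> real"
  have expand: "(\<Sum>i<Suc d. \<Sum>j<Suc d. v i * q i j * v j)
      = (\<Sum>i<d. \<Sum>j<d. v i * q i j * v j) + 2 * v d * s v + a * (v d)\<^sup>2" for v :: "nat \<Rightarrow> real"
  proof -
    have "(\<Sum>j<d. v d * q d j * v j) = v d * s v"
      unfolding s_def sum_distrib_left by (intro sum.cong refl) (simp add: sym)
    moreover have "(\<Sum>i<d. v i * q i d * v d) = v d * s v"
      unfolding s_def sum_distrib_left by (intro sum.cong refl) simp
    ultimately show ?thesis
      by (simp add: sum.distrib a_def power2_eq_square)
  qed
  have "0 \<le> a"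
    using nonneg[of "\<lambda>i. if i = d then 1 else 0"] unfolding expand by (simp add: s_def)
  \<comment> \<open>A zero on the diagonal kills its column: the form is then affine in the last
    coordinate, and \<open>t\<close> is chosen so that its value is -1.\<close>
  have zero: "q i d = 0" if "a = 0" "i < d" for i
  proof (rule ccontr)
    assume "q i d \<noteq> 0"
    define t where "t = - (q i i + 1) / (2 * q i d)"
    define v :: "nat \<Rightarrow> real" where "v j = (if j = i then 1 else if j = d then t else 0)" for j
    have "(\<Sum>k<d. \<Sum>j<d. v k * q k j * v j) = q i i"
    proof -
      have "(\<Sum>k<d. \<Sum>j<d. v k * q k j * v j) = (\<Sum>k<d. if k = i then q i i else 0)"
        using that(2) by (intro sum.cong refl) (auto simp: v_def if_distrib cong: if_cong)
      then show ?thesis using that(2) by simp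
    qed
    moreover have "s v = q i d"
    proof -
      have "s v = (\<Sum>k<d. if k = i then q i d else 0)"
        unfolding s_def by (intro sum.cong refl) (auto simp: v_def)
      then show ?thesis using that(2) by simp
    qed
    moreover have "v d = t"
      using that(2) by (simp add: v_def)
    ultimately have "0 \<le> q i i + 2 * t * q i d"
      using nonneg[of v] unfolding expand by (simp add: that(1))
    moreover have "2 * t * q i d = - (q i i + 1)"
      using \<open>q i d \<noteq> 0\<close> by (simp add: t_def)
    ultimately show False by linarith
  qed
  define q' where "q' i j = q i j - q i d * q j d / a" for i j
  have nonneg': "0 \<le> (\<Sum>i<d. \<Sum>j<d. v i * q' i j * v j)" for v :: "nat \<Rightarrow> real"
  proof -
    have "s v * s v = (\<Sum>i<d. \<Sum>j<d. v i * (q i d * q j d) * v j)"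
      unfolding s_def sum_product by (intro sum.cong refl) simp
    then have "(\<Sum>i<d. \<Sum>j<d. v i * q' i j * v j)
        = (\<Sum>i<d. \<Sum>j<d. v i * q i j * v j) - s v * s v / a"
      by (simp add: q'_def algebra_simps sum_subtractf sum_divide_distrib)
    moreover have "0 \<le> (\<Sum>i<d. \<Sum>j<d. v i * q i j * v j) - s v * s v / a"
    proof -
      \<comment> \<open>This last coordinate minimises \<open>a\<close> t^2 + 2 t \<open>s v\<close>
        over t. For \<open>a = 0\<close>, division by zero makes it 0 and the correction term
        vanishes, so both cases share one formula.\<close>
      define u where "u = v(d := - s v / a)"
      have "u d = - s v / a" "s u = s v" "(\<Sum>i<d. \<Sum>j<d. u i * q i j * u j) = (\<Sum>i<d. \<Sum>j<d. v i * q i j * v j)"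
        by (simp_all add: s_def u_def)
      then have "0 \<le> (\<Sum>i<d. \<Sum>j<d. v i * q i j * v j) + 2 * (- s v / a) * s v + a * (- s v / a)\<^sup>2"
        using nonneg[of u] unfolding expand by (simp only:)
      then show ?thesis
        by (cases "a = 0") (auto simp: power2_eq_square)
    qed
    ultimately show ?thesis by simp
  qed
  have "\<exists>c. \<forall>i<d. \<forall>j<d. q' i j = (\<Sum>l<d. c l i * c l j)"
    by (rule Suc.IH[OF _ nonneg']) (simp add: q'_def sym)
  then obtain c where c: "\<And>i j. i < d \<Longrightarrow> j < d \<Longrightarrow> q' i j = (\<Sum>l<d. c l i * c l j)"
    by blast
  \<comment> \<open>A Cholesky step: the vectors for \<open>q'\<close> are padded with a last
    coordinate 0, and the last column of \<open>q\<close>, scaled by 1 / sqrt \<open>a\<close>, is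
    added. For \<open>a = 0\<close> the added vector is 0, which is right because
    \<open>zero\<close> says that the column vanishes.\<close>
  define c' where "c' l i = (if l < d then if i < d then c l i else 0 else q i d / sqrt a)" for l i
  have "q i j = (\<Sum>l<Suc d. c' l i * c' l j)" if "i < Suc d" "j < Suc d" for i j
  proof -
    have "(\<Sum>l<d. c' l i * c' l j) = (if i < d \<and> j < d then q' i j else 0)"
      by (auto simp: c'_def c)
    moreover have "c' d i * c' d j = q i d * q j d / a"
      using \<open>0 \<le> a\<close> by (simp add: c'_def)
    moreover have "q i j = q i d * q j d / a" if "\<not> (i < d \<and> j < d)"
      using that \<open>i < Suc d\<close> \<open>j < Suc d\<close> zero[of i] zero[of j] sym[of d j] a_def
      by (cases "a = 0") (auto simp: less_Suc_eq)
    ultimately show ?thesis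
      by (simp add: q'_def)
  qed
  then show ?case by blast
qed

lemma scalar_prod_mult_mat_vec:
  fixes X :: "'a :: semiring_0 mat"
  assumes "X \<in> carrier_mat d d" "v \<in> carrier_vec d" "u \<in> carrier_vec d"
  shows "v \<bullet> (X *\<^sub>v u) = (\<Sum>i<d. \<Sum>j<d. v $ i * X $$ (i, j) * u $ j)"
  using assms
  by (simp add: scalar_prod_def sum_distrib_left lessThan_atLeast0 mult.assoc)

lemma psd_decomposition:
  assumes "psd d Q"
  obtains c where "\<And>l. c l \<in> carrier_vec d"
    and "\<And>i j. i < d \<Longrightarrow> j < d \<Longrightarrow> Q $$ (i, j) = (\<Sum>l<d. c l $ i * c l $ j)"
proof -
  have Q: "Q \<in> carrier_mat d d" "Q\<^sup>T = Q"
    using assms by (auto simp: psd_def)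
  have "\<exists>c. \<forall>i<d. \<forall>j<d. Q $$ (i, j) = (\<Sum>l<d. c l i * c l j)"
  proof (rule psd_kernel_decomposition)
    show "Q $$ (i, j) = Q $$ (j, i)" if "i < d" "j < d" for i j
      using Q that by (metis carrier_matD index_transpose_mat(1))
    show "0 \<le> (\<Sum>i<d. \<Sum>j<d. v i * Q $$ (i, j) * v j)" for v :: "nat \<Rightarrow> real"
    proof -
      have "0 \<le> vec d v \<bullet> (Q *\<^sub>v vec d v)"
        using assms by (simp add: psd_def)
      then show ?thesis
        using Q(1) by (simp add: scalar_prod_mult_mat_vec)
    qed
  qed
  then obtain c where "\<forall>i<d. \<forall>j<d. Q $$ (i, j) = (\<Sum>l<d. c l i * c l j)" by blast
  then show thesis
    by (intro that[of "\<lambda>l. vec d (c l)"]) simp_all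
qed

lemma quadratic_form_decomposition:
  fixes Q :: "real mat"
  assumes "Q \<in> carrier_mat d d" "\<And>l. c l \<in> carrier_vec d" "v \<in> carrier_vec d"
    and Q: "\<And>i j. i < d \<Longrightarrow> j < d \<Longrightarrow> Q $$ (i, j) = (\<Sum>l<d. c l $ i * c l $ j)"
  shows "v \<bullet> (Q *\<^sub>v v) = (\<Sum>l<d. (c l \<bullet> v)\<^sup>2)"
proof -
  have "v \<bullet> (Q *\<^sub>v v) = (\<Sum>i<d. \<Sum>j<d. \<Sum>l<d. (c l $ i * v $ i) * (c l $ j * v $ j))"
  proof -
    have "v $ i * Q $$ (i, j) * v $ j = (\<Sum>l<d. (c l $ i * v $ i) * (c l $ j * v $ j))"
      if "i < d" "j < d" for i j
      unfolding Q[OF that] sum_distrib_left sum_distrib_right by (rule sum.cong) (simp_all add: mult_ac)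
    then show ?thesis
      unfolding scalar_prod_mult_mat_vec[OF assms(1,3,3)] by simp
  qed
  also have "\<dots> = (\<Sum>i<d. \<Sum>l<d. \<Sum>j<d. (c l $ i * v $ i) * (c l $ j * v $ j))"
    by (rule sum.cong[OF refl], rule sum.swap)
  also have "\<dots> = (\<Sum>l<d. \<Sum>i<d. \<Sum>j<d. (c l $ i * v $ i) * (c l $ j * v $ j))"
    by (rule sum.swap)
  also have "\<dots> = (\<Sum>l<d. (c l \<bullet> v)\<^sup>2)"
    using assms(3) by (simp add: power2_eq_square scalar_prod_def sum_product lessThan_atLeast0)
  finally show ?thesis .
qed

text \<open>Termwise tr(c c^T S) = c . S c. With \<open>quadratic_form_decomposition\<close>, which
  splits the cost along the same vectors \<open>c l\<close>, it lets the true and the relaxed cost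
  be compared one direction at a time.\<close>

lemma mat_trace_decomposition:
  assumes "Q \<in> carrier_mat d d" "S \<in> carrier_mat d d" "\<And>l. c l \<in> carrier_vec d"
    and Q: "\<And>i j. i < d \<Longrightarrow> j < d \<Longrightarrow> Q $$ (i, j) = (\<Sum>l<d. c l $ i * c l $ j)"
  shows "mat_trace (Q * S) = (\<Sum>l<d. c l \<bullet> (S *\<^sub>v c l))"
proof -
  have "mat_trace (Q * S) = (\<Sum>i<d. \<Sum>j<d. Q $$ (i, j) * S $$ (j, i))"
    using assms(1,2) by (simp add: mat_trace_def scalar_prod_def lessThan_atLeast0)
  also have "\<dots> = (\<Sum>i<d. \<Sum>j<d. \<Sum>l<d. c l $ j * S $$ (j, i) * c l $ i)"
  proof -
    have "Q $$ (i, j) * S $$ (j, i) = (\<Sum>l<d. c l $ j * S $$ (j, i) * c l $ i)"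
      if "i < d" "j < d" for i j
      unfolding Q[OF that] sum_distrib_right by (rule sum.cong) (simp_all add: mult_ac)
    then show ?thesis by simp
  qed
  also have "\<dots> = (\<Sum>j<d. \<Sum>i<d. \<Sum>l<d. c l $ j * S $$ (j, i) * c l $ i)"
    by (rule sum.swap)
  also have "\<dots> = (\<Sum>j<d. \<Sum>l<d. \<Sum>i<d. c l $ j * S $$ (j, i) * c l $ i)"
    by (rule sum.cong[OF refl], rule sum.swap)
  also have "\<dots> = (\<Sum>l<d. \<Sum>j<d. \<Sum>i<d. c l $ j * S $$ (j, i) * c l $ i)"
    by (rule sum.swap)
  also have "\<dots> = (\<Sum>l<d. c l \<bullet> (S *\<^sub>v c l))"
    by (simp add: scalar_prod_mult_mat_vec[OF assms(2,3,3)])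
  finally show ?thesis .
qed

lemma psd_stage_weight:
  assumes "psd n Q" "pos_def m R"
  shows "psd (n + m) (stage_weight n m Q R)"
  unfolding psd_def
proof (intro conjI ballI)
  have Q: "Q \<in> carrier_mat n n" "Q\<^sup>T = Q" and R: "R \<in> carrier_mat m m" "R\<^sup>T = R"
    using assms by (auto simp: psd_def pos_def_def)
  show "stage_weight n m Q R \<in> carrier_mat (n + m) (n + m)"
    using Q R by (simp add: stage_weight_def)
  show "(stage_weight n m Q R)\<^sup>T = stage_weight n m Q R"
    using Q R unfolding stage_weight_def
    by (subst transpose_four_block_mat[of _ n n _ m _ m]) auto
  fix v :: "real vec" assume "v \<in> carrier_vec (n + m)"
  then obtain a b where v: "v = a @\<^sub>v b" "a \<in> carrier_vec n" "b \<in> carrier_vec m"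
    by (metis vec_first_carrier vec_first_last_append vec_last_carrier)
  have "0 \<le> b \<bullet> (R *\<^sub>v b)"
    using assms(2) v(3) R(1) by (cases "b = 0\<^sub>v m") (auto simp: pos_def_def less_imp_le)
  moreover have "0 \<le> a \<bullet> (Q *\<^sub>v a)"
    using assms(1) v(2) by (simp add: psd_def)
  moreover have "stage_weight n m Q R *\<^sub>v v = (Q *\<^sub>v a) @\<^sub>v (R *\<^sub>v b)"
  proof -
    have "stage_weight n m Q R *\<^sub>v v
        = (Q *\<^sub>v a + 0\<^sub>m n m *\<^sub>v b) @\<^sub>v (0\<^sub>m m n *\<^sub>v a + R *\<^sub>v b)"
      unfolding stage_weight_def v(1) by (rule four_block_mat_mult_vec) (use Q R v in auto)
    moreover have "0\<^sub>m n m *\<^sub>v b = 0\<^sub>v n" "0\<^sub>m m n *\<^sub>v a = 0\<^sub>v m"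
      using v by auto
    ultimately show ?thesis using Q R v by simp
  qed
  ultimately show "0 \<le> v \<bullet> (stage_weight n m Q R *\<^sub>v v)"
    using v Q(1) R(1) by (simp add: scalar_prod_append[of _ n _ m])
qed

section \<open>Block matrices\<close>

lemma append_columns_carrier:
  assumes "A \<in> carrier_mat n p" "B \<in> carrier_mat n q"
  shows "append_columns A B \<in> carrier_mat n (p + q)"
  using assms unfolding append_columns_def carrier_mat_def by auto

lemma append_columns_mult_vec:
  assumes "A \<in> carrier_mat n p" "B \<in> carrier_mat n q" "a \<in> carrier_vec p" "b \<in> carrier_vec q"
  shows "append_columns A B *\<^sub>v (a @\<^sub>v b) = A *\<^sub>v a + B *\<^sub>v b"
proof -
  have "append_columns A B *\<^sub>v (a @\<^sub>v b)
      = (A *\<^sub>v a + B *\<^sub>v b) @\<^sub>v (0\<^sub>m 0 p *\<^sub>v a + 0\<^sub>m 0 q *\<^sub>v b)"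
  proof -
    have "dim_col A = p" "dim_col B = q" using assms by auto
    then show ?thesis
      unfolding append_columns_def by (simp only:) (rule four_block_mat_mult_vec, use assms in auto)
  qed
  also have "\<dots> = A *\<^sub>v a + B *\<^sub>v b"
    by (rule eq_vecI) (use assms in auto)
  finally show ?thesis .
qed

lemma transpose_append_columns_mult_vec:
  assumes "A \<in> carrier_mat n p" "B \<in> carrier_mat n q" "v \<in> carrier_vec n"
  shows "(append_columns A B)\<^sup>T *\<^sub>v v = (A\<^sup>T *\<^sub>v v) @\<^sub>v (B\<^sup>T *\<^sub>v v)"
proof (rule eq_vecI)
  fix i assume i: "i < dim_vec ((A\<^sup>T *\<^sub>v v) @\<^sub>v (B\<^sup>T *\<^sub>v v))"
  have "col (append_columns A B) i = (if i < p then col A i else col B (i - p))"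
    using assms i unfolding append_columns_def by (intro eq_vecI) auto
  then show "((append_columns A B)\<^sup>T *\<^sub>v v) $ i = ((A\<^sup>T *\<^sub>v v) @\<^sub>v (B\<^sup>T *\<^sub>v v)) $ i"
    using assms i append_columns_carrier[OF assms(1,2)] by simp
qed (use assms append_columns_carrier[OF assms(1,2)] in auto)

section \<open>Block-diagonal matrices and the subvectors they act on\<close>

lemma blkdiag_0: "blkdiag 0 X = 0\<^sub>m 0 0"
  by (simp add: blkdiag_def)

lemma blkdiag_carrier:
  assumes "\<And>i. i < M \<Longrightarrow> X i \<in> carrier_mat (ps i) (qs i)"
  shows "blkdiag M X \<in> carrier_mat (\<Sum>i<M. ps i) (\<Sum>i<M. qs i)"
proof -
  have "sum_list (map (\<lambda>i. dim_row (X i)) [0..<M]) = (\<Sum>i<M. ps i)"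
    "sum_list (map (\<lambda>i. dim_col (X i)) [0..<M]) = (\<Sum>i<M. qs i)"
    using assms[THEN carrier_matD(1)] assms[THEN carrier_matD(2)]
    by (simp_all add: interv_sum_list_conv_sum_set_nat lessThan_atLeast0)
  then show ?thesis
    unfolding blkdiag_def by (intro carrier_matI) (simp_all add: dim_diag_block_mat o_def)
qed

text \<open>Splitting off the last block reduces facts about \<open>blkdiag\<close> to 2 by 2 block
  matrices. With the last block instead of the first, the remaining dimensions are the sums over
  \<open>i<M\<close> of the induction hypothesis, and no index is shifted.\<close>

lemma blkdiag_Suc:
  assumes "\<And>i. i < Suc M \<Longrightarrow> X i \<in> carrier_mat (ps i) (qs i)"
  shows "blkdiag (Suc M) X = four_block_mat (blkdiag M X) (0\<^sub>m (\<Sum>i<M. ps i) (qs M))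
    (0\<^sub>m (ps M) (\<Sum>i<M. qs i)) (X M)"
proof -
  have "blkdiag M X \<in> carrier_mat (\<Sum>i<M. ps i) (\<Sum>i<M. qs i)" "X M \<in> carrier_mat (ps M) (qs M)"
    using assms by (auto intro!: blkdiag_carrier)
  then show ?thesis
    by (auto simp: blkdiag_def diag_block_mat_last Let_def)
qed

lemma blkdiag_transpose:
  assumes "\<And>i. i < M \<Longrightarrow> X i \<in> carrier_mat (ps i) (qs i)"
  shows "(blkdiag M X)\<^sup>T = blkdiag M (\<lambda>i. (X i)\<^sup>T)"
  using assms
proof (induction M)
  case 0
  then show ?case by (simp add: blkdiag_0)
next
  case (Suc M)
  have X: "blkdiag M X \<in> carrier_mat (\<Sum>i<M. ps i) (\<Sum>i<M. qs i)" "X M \<in> carrier_mat (ps M) (qs M)"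
    using Suc.prems by (auto intro!: blkdiag_carrier)
  have "blkdiag (Suc M) (\<lambda>i. (X i)\<^sup>T) = four_block_mat (blkdiag M (\<lambda>i. (X i)\<^sup>T))
      (0\<^sub>m (\<Sum>i<M. qs i) (ps M)) (0\<^sub>m (qs M) (\<Sum>i<M. ps i)) ((X M)\<^sup>T)"
    by (rule blkdiag_Suc) (simp add: Suc.prems)
  then show ?case
    using X Suc.IH Suc.prems
    by (subst blkdiag_Suc[of M X ps qs], simp,
        subst transpose_four_block_mat[of _ "\<Sum>i<M. ps i" "\<Sum>i<M. qs i" _ "qs M" _ "ps M"]) simp_all
qed

lemma blkdiag_mult:
  assumes "\<And>i. i < M \<Longrightarrow> X i \<in> carrier_mat (ps i) (qs i)"
    and "\<And>i. i < M \<Longrightarrow> Y i \<in> carrier_mat (qs i) (rs i)"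
  shows "blkdiag M X * blkdiag M Y = blkdiag M (\<lambda>i. X i * Y i)"
  using assms
proof (induction M)
  case 0
  then show ?case by (simp add: blkdiag_0)
next
  case (Suc M)
  have X: "blkdiag M X \<in> carrier_mat (\<Sum>i<M. ps i) (\<Sum>i<M. qs i)" "X M \<in> carrier_mat (ps M) (qs M)"
    and Y: "blkdiag M Y \<in> carrier_mat (\<Sum>i<M. qs i) (\<Sum>i<M. rs i)" "Y M \<in> carrier_mat (qs M) (rs M)"
    using Suc.prems by (auto intro!: blkdiag_carrier)
  have IH: "blkdiag M X * blkdiag M Y = blkdiag M (\<lambda>i. X i * Y i)"
    using Suc by simp
  have XY: "blkdiag (Suc M) (\<lambda>i. X i * Y i) = four_block_mat (blkdiag M (\<lambda>i. X i * Y i))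
      (0\<^sub>m (\<Sum>i<M. ps i) (rs M)) (0\<^sub>m (ps M) (\<Sum>i<M. rs i)) (X M * Y M)"
    by (rule blkdiag_Suc) (use Suc.prems in \<open>blast intro: mult_carrier_mat\<close>)
  have "blkdiag (Suc M) X * blkdiag (Suc M) Y
      = four_block_mat (blkdiag M X * blkdiag M Y + 0\<^sub>m (\<Sum>i<M. ps i) (qs M) * 0\<^sub>m (qs M) (\<Sum>i<M. rs i))
          (blkdiag M X * 0\<^sub>m (\<Sum>i<M. qs i) (rs M) + 0\<^sub>m (\<Sum>i<M. ps i) (qs M) * Y M)
          (0\<^sub>m (ps M) (\<Sum>i<M. qs i) * blkdiag M Y + X M * 0\<^sub>m (qs M) (\<Sum>i<M. rs i))
          (0\<^sub>m (ps M) (\<Sum>i<M. qs i) * 0\<^sub>m (\<Sum>i<M. qs i) (rs M) + X M * Y M)"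
    by (subst blkdiag_Suc[of M X ps qs], simp add: Suc.prems(1),
        subst blkdiag_Suc[of M Y qs rs], simp add: Suc.prems(2),
        rule mult_four_block_mat) (use X Y in auto)
  moreover have "blkdiag M X * blkdiag M Y \<in> carrier_mat (\<Sum>i<M. ps i) (\<Sum>i<M. rs i)"
    "X M * Y M \<in> carrier_mat (ps M) (rs M)"
    using X Y by auto
  ultimately show ?case
    unfolding XY IH[symmetric] using X Y by simp
qed

lemma det_blkdiag:
  assumes "\<And>i. i < M \<Longrightarrow> X i \<in> carrier_mat (ps i) (ps i)"
  shows "det (blkdiag M X) = (\<Prod>i<M. det (X i))"
  using assms
proof (induction M)
  case 0
  then show ?case by (simp add: blkdiag_0)
next
  case (Suc M)
  have "blkdiag M X \<in> carrier_mat (\<Sum>i<M. ps i) (\<Sum>i<M. ps i)" "X M \<in> carrier_mat (ps M) (ps M)"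
    using Suc.prems by (auto intro!: blkdiag_carrier)
  then show ?case
    using Suc by (subst blkdiag_Suc[OF Suc.prems])
      (auto simp: det_four_block_mat_lower_left_zero[of _ "\<Sum>i<M. ps i" _ "ps M"])
qed

lemma vec_block_append_less:
  assumes "a \<in> carrier_vec (\<Sum>i<M. ds i)" "b \<in> carrier_vec d" "i < M"
  shows "vec_block ds i (a @\<^sub>v b) = vec_block ds i a"
proof -
  have "(\<Sum>l<i. ds l) + ds i \<le> (\<Sum>l<M. ds l)"
    using sum_mono2[of "{..<M}" "{..<Suc i}" ds] assms(3) by auto
  then show ?thesis
    using assms by (intro eq_vecI) (auto simp: vec_block_def)
qed

lemma vec_block_append_last:
  assumes "a \<in> carrier_vec (\<Sum>i<M. ds i)" "b \<in> carrier_vec (ds M)"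
  shows "vec_block ds M (a @\<^sub>v b) = b"
  using assms by (intro eq_vecI) (auto simp: vec_block_def)

lemma vec_block_blkdiag_mult:
  assumes "\<And>i. i < M \<Longrightarrow> X i \<in> carrier_mat (ps i) (qs i)"
    and "v \<in> carrier_vec (\<Sum>i<M. qs i)" "i < M"
  shows "vec_block ps i (blkdiag M X *\<^sub>v v) = X i *\<^sub>v vec_block qs i v"
  using assms
proof (induction M arbitrary: v)
  case 0
  then show ?case by simp
next
  case (Suc M)
  obtain a b where v: "v = a @\<^sub>v b" "a \<in> carrier_vec (\<Sum>i<M. qs i)" "b \<in> carrier_vec (qs M)"
    using Suc.prems(2) by (metis sum.lessThan_Suc vec_first_carrier vec_first_last_append vec_last_carrier)
  have X: "blkdiag M X \<in> carrier_mat (\<Sum>i<M. ps i) (\<Sum>i<M. qs i)" "X M \<in> carrier_mat (ps M) (qs M)"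
    using Suc.prems by (auto intro!: blkdiag_carrier)
  have "blkdiag (Suc M) X *\<^sub>v v = (blkdiag M X *\<^sub>v a + 0\<^sub>m (\<Sum>i<M. ps i) (qs M) *\<^sub>v b)
      @\<^sub>v (0\<^sub>m (ps M) (\<Sum>i<M. qs i) *\<^sub>v a + X M *\<^sub>v b)"
    unfolding v(1)
    by (subst blkdiag_Suc[of M X ps qs], simp add: Suc.prems(1),
        rule four_block_mat_mult_vec) (use X v in auto)
  moreover have "0\<^sub>m (\<Sum>i<M. ps i) (qs M) *\<^sub>v b = 0\<^sub>v (\<Sum>i<M. ps i)"
    "0\<^sub>m (ps M) (\<Sum>i<M. qs i) *\<^sub>v a = 0\<^sub>v (ps M)"
    using v by auto
  ultimately have eq: "blkdiag (Suc M) X *\<^sub>v v = (blkdiag M X *\<^sub>v a) @\<^sub>v (X M *\<^sub>v b)"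
    using X v by simp
  have c: "blkdiag M X *\<^sub>v a \<in> carrier_vec (\<Sum>i<M. ps i)" "X M *\<^sub>v b \<in> carrier_vec (ps M)"
    using X v by auto
  show ?case
  proof (cases "i = M")
    case True
    then show ?thesis
      unfolding eq unfolding v(1) using c v by (simp add: vec_block_append_last)
  next
    case False
    then have "i < M" using Suc.prems(3) by simp
    then show ?thesis
      unfolding eq unfolding v(1) using Suc c v by (simp add: vec_block_append_less)
  qed
qed

text \<open>The policy prescribes the input agent by agent; this turns it into the single equation u
  = F x that the closed-loop analysis uses.\<close>

lemma vec_block_eqI:
  assumes "u \<in> carrier_vec (\<Sum>i<M. ds i)" "v \<in> carrier_vec (\<Sum>i<M. ds i)"
    and "\<And>i. i < M \<Longrightarrow> vec_block ds i u = vec_block ds i v"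
  shows "u = v"
  using assms
proof (induction M arbitrary: u v)
  case 0
  then show ?case by auto
next
  case (Suc M)
  obtain a b where u: "u = a @\<^sub>v b" "a \<in> carrier_vec (\<Sum>i<M. ds i)" "b \<in> carrier_vec (ds M)"
    using Suc.prems(1) by (metis sum.lessThan_Suc vec_first_carrier vec_first_last_append vec_last_carrier)
  obtain a' b' where v: "v = a' @\<^sub>v b'" "a' \<in> carrier_vec (\<Sum>i<M. ds i)" "b' \<in> carrier_vec (ds M)"
    using Suc.prems(2) by (metis sum.lessThan_Suc vec_first_carrier vec_first_last_append vec_last_carrier)
  have "a = a'"
  proof (rule Suc.IH)
    show "vec_block ds i a = vec_block ds i a'" if "i < M" for i
      using Suc.prems(3)[of i] that u v by (simp add: vec_block_append_less)
  qed (use u v in auto)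
  moreover have "b = b'"
    using Suc.prems(3)[of M] u v by (simp add: vec_block_append_last)
  ultimately show ?case using u v by simp
qed

section \<open>Inverses of matrices with nonzero determinant\<close>

lemma mat_inv_inverts:
  assumes "X \<in> carrier_mat d d" "det X \<noteq> 0"
  shows "mat_inv X \<in> carrier_mat d d" "X * mat_inv X = 1\<^sub>m d" "mat_inv X * X = 1\<^sub>m d"
proof -
  \<comment> \<open>\<open>mat_inverse\<close> returns \<open>None\<close> only for non-units of the
    matrix ring; \<open>()\<close> fills the extension slot of the ring record.\<close>
  obtain Y where "mat_inverse X = Some Y"
    using mat_inverse(1)[OF assms(1), of "()"] det_non_zero_imp_unit[OF assms, of "()"] by auto
  then show "mat_inv X \<in> carrier_mat d d" "X * mat_inv X = 1\<^sub>m d" "mat_inv X * X = 1\<^sub>m d"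
    using mat_inverse(2)[OF assms(1)] by (auto simp: mat_inv_def)
qed

lemma invertible_mat_if_det:
  fixes X :: "real mat"
  assumes "X \<in> carrier_mat d d" "det X \<noteq> 0"
  shows "invertible_mat X"
  using assms(1) mat_inv_inverts[OF assms]
  by (auto simp: invertible_mat_def inverts_mat_def intro!: exI[of _ "mat_inv X"])

section \<open>The linear matrix inequality\<close>

text \<open>The matrix inequality evaluated at the vector (a, b, q). The two off-diagonal blocks
  contribute equal amounts, as do \<open>G\<close> and its transpose, hence the factors 2. All later
  consequences of the inequality arise by choosing a, b and q.\<close>

lemma relax_lmi_quadratic_form:
  assumes lmi: "relax_lmi n m S G L V"
    and c: "S \<in> carrier_mat (n + m) (n + m)" "G \<in> carrier_mat n n" "L \<in> carrier_mat n m"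
      "V \<in> carrier_mat n n"
    and v: "a \<in> carrier_vec n" "b \<in> carrier_vec m" "q \<in> carrier_vec n"
  shows "0 \<le> (a @\<^sub>v b) \<bullet> (S *\<^sub>v (a @\<^sub>v b)) + 2 * (q \<bullet> (G *\<^sub>v a + L *\<^sub>v b))
    + 2 * (q \<bullet> (G *\<^sub>v q)) - q \<bullet> (V *\<^sub>v q)"
proof -
  let ?p = "a @\<^sub>v b" and ?H = "append_columns G L" and ?D = "G + G\<^sup>T - V"
  have p: "?p \<in> carrier_vec (n + m)" using v by simp
  have H: "?H \<in> carrier_mat n (n + m)"
    using c by (simp add: append_columns_carrier)
  have D: "?D \<in> carrier_mat n n" using c by (intro minus_carrier_mat)
  have "0 \<le> (?p @\<^sub>v q) \<bullet> (four_block_mat S (?H\<^sup>T) ?H ?D *\<^sub>v (?p @\<^sub>v q))"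
    using lmi v unfolding relax_lmi_def psd_def by auto
  also have "four_block_mat S (?H\<^sup>T) ?H ?D *\<^sub>v (?p @\<^sub>v q)
      = (S *\<^sub>v ?p + ?H\<^sup>T *\<^sub>v q) @\<^sub>v (?H *\<^sub>v ?p + ?D *\<^sub>v q)"
    by (rule four_block_mat_mult_vec) (use c H D p v in auto)
  also have "(?p @\<^sub>v q) \<bullet> \<dots> = ?p \<bullet> (S *\<^sub>v ?p + ?H\<^sup>T *\<^sub>v q) + q \<bullet> (?H *\<^sub>v ?p + ?D *\<^sub>v q)"
    by (rule scalar_prod_append[of _ "n + m" _ n]) (use c H D p v in auto)
  also have "?p \<bullet> (S *\<^sub>v ?p + ?H\<^sup>T *\<^sub>v q) = ?p \<bullet> (S *\<^sub>v ?p) + ?p \<bullet> (?H\<^sup>T *\<^sub>v q)"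
    by (rule scalar_prod_add_distrib) (use c H p v in auto)
  also have "?p \<bullet> (?H\<^sup>T *\<^sub>v q) = q \<bullet> (?H *\<^sub>v ?p)"
    using transpose_vec_mult_scalar[OF H p v(3)] comm_scalar_prod[OF p, of "?H\<^sup>T *\<^sub>v q"] H v by simp
  also have "q \<bullet> (?H *\<^sub>v ?p + ?D *\<^sub>v q) = q \<bullet> (?H *\<^sub>v ?p) + q \<bullet> (?D *\<^sub>v q)"
    by (rule scalar_prod_add_distrib) (use H D p v in auto)
  also have "?D *\<^sub>v q = G *\<^sub>v q + G\<^sup>T *\<^sub>v q - V *\<^sub>v q"
    using c v by (simp add: minus_mult_distrib_mat_vec[of _ n n] add_mult_distrib_mat_vec[of _ n n])
  also have "q \<bullet> \<dots> = q \<bullet> (G *\<^sub>v q + G\<^sup>T *\<^sub>v q) - q \<bullet> (V *\<^sub>v q)"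
    by (rule scalar_prod_minus_distrib) (use c v in auto)
  also have "q \<bullet> (G *\<^sub>v q + G\<^sup>T *\<^sub>v q) = q \<bullet> (G *\<^sub>v q) + q \<bullet> (G\<^sup>T *\<^sub>v q)"
    by (rule scalar_prod_add_distrib) (use c v in auto)
  also have "q \<bullet> (G\<^sup>T *\<^sub>v q) = q \<bullet> (G *\<^sub>v q)"
    using transpose_vec_mult_scalar[OF c(2) v(3,3)] comm_scalar_prod[OF v(3), of "G\<^sup>T *\<^sub>v q"] c v
    by simp
  also have "?H *\<^sub>v ?p = G *\<^sub>v a + L *\<^sub>v b"
    using c v by (simp add: append_columns_mult_vec)
  finally show ?thesis by simp
qed

text \<open>At q = 0 only the upper left block is seen. This is what keeps the next covariance
  bound, a congruence of \<open>S\<close> plus \<open>W\<close>, positive definite.\<close>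

lemma relax_lmi_psd:
  assumes "relax_lmi n m S G L V"
    and c: "S \<in> carrier_mat (n + m) (n + m)" "G \<in> carrier_mat n n" "L \<in> carrier_mat n m"
      "V \<in> carrier_mat n n"
    and v: "v \<in> carrier_vec (n + m)"
  shows "0 \<le> v \<bullet> (S *\<^sub>v v)"
proof -
  obtain a b where ab: "v = a @\<^sub>v b" "a \<in> carrier_vec n" "b \<in> carrier_vec m"
    using v by (metis vec_first_carrier vec_first_last_append vec_last_carrier)
  have "G *\<^sub>v a + L *\<^sub>v b \<in> carrier_vec n" using c ab by auto
  then show ?thesis
    using relax_lmi_quadratic_form[OF assms(1) c ab(2,3), of "0\<^sub>v n"] c ab by simp
qed

text \<open>At a = 0, b = 0 and q = v with G v = 0, both terms with \<open>G\<close> vanish and - v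
  . V v >= 0 remains, against the positivity of \<open>V\<close>.\<close>

lemma relax_lmi_det:
  assumes "relax_lmi n m S G L V"
    and c: "S \<in> carrier_mat (n + m) (n + m)" "G \<in> carrier_mat n n" "L \<in> carrier_mat n m"
      "V \<in> carrier_mat n n"
    and V: "\<And>v. v \<in> carrier_vec n \<Longrightarrow> v \<noteq> 0\<^sub>v n \<Longrightarrow> 0 < v \<bullet> (V *\<^sub>v v)"
  shows "det G \<noteq> 0"
proof
  assume "det G = 0"
  then obtain v where v: "v \<in> carrier_vec n" "v \<noteq> 0\<^sub>v n" "G *\<^sub>v v = 0\<^sub>v n"
    using det_0_iff_vec_prod_zero[OF c(2)] by blast
  have "0\<^sub>v n @\<^sub>v 0\<^sub>v m = (0\<^sub>v (n + m) :: real vec)"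
    by (rule eq_vecI) auto
  moreover have "G *\<^sub>v 0\<^sub>v n = 0\<^sub>v n" "L *\<^sub>v 0\<^sub>v m = 0\<^sub>v n" "S *\<^sub>v 0\<^sub>v (n + m) = 0\<^sub>v (n + m)"
    using c by auto
  ultimately show False
    using relax_lmi_quadratic_form[OF assms(1) c, of "0\<^sub>v n" "0\<^sub>v m" v] v V[OF v(1,2)] by simp
qed

text \<open>Testing the inequality at \<open>(p, - y)\<close> with \<open>y = [I F\<^sup>T] p\<close> cancels every term containing \<open>G\<close>,
  which gives \<open>S \<succeq> [I; F] V [I; F]\<^sup>T\<close>.\<close>

lemma relax_lmi_bound:
  assumes "relax_lmi n m S G (G * F\<^sup>T) V"
    and c: "S \<in> carrier_mat (n + m) (n + m)" "G \<in> carrier_mat n n" "F \<in> carrier_mat m n"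
      "V \<in> carrier_mat n n"
    and v: "a \<in> carrier_vec n" "b \<in> carrier_vec m"
  shows "(a + F\<^sup>T *\<^sub>v b) \<bullet> (V *\<^sub>v (a + F\<^sup>T *\<^sub>v b)) \<le> (a @\<^sub>v b) \<bullet> (S *\<^sub>v (a @\<^sub>v b))"
proof -
  define y where "y = a + F\<^sup>T *\<^sub>v b"
  have y: "y \<in> carrier_vec n" using c v by (auto simp: y_def)
  \<comment> \<open>Since \<open>L\<close> is \<open>G * F\<^sup>T\<close>, the linear term sees (a,
    b) only through \<open>y\<close>. It thus becomes 2 q . G y, which q = - y makes opposite to 2 q
    . G q.\<close>
  have "G *\<^sub>v a + (G * F\<^sup>T) *\<^sub>v b = G *\<^sub>v a + G *\<^sub>v (F\<^sup>T *\<^sub>v b)"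
    using c v by (subst assoc_mult_mat_vec[of _ n n _ m]) auto
  also have "\<dots> = G *\<^sub>v y"
    unfolding y_def by (rule mult_add_distrib_mat_vec[symmetric]) (use c v in auto)
  finally have Gy: "G *\<^sub>v a + (G * F\<^sup>T) *\<^sub>v b = G *\<^sub>v y" .
  have neg: "X *\<^sub>v (- y) = - (X *\<^sub>v y)" if "X \<in> carrier_mat n n" for X
    using that y by (intro eq_vecI) auto
  have "0 \<le> (a @\<^sub>v b) \<bullet> (S *\<^sub>v (a @\<^sub>v b)) + 2 * (- y \<bullet> (G *\<^sub>v y))
      + 2 * (- y \<bullet> (G *\<^sub>v (- y))) - (- y) \<bullet> (V *\<^sub>v (- y))"
    using relax_lmi_quadratic_form[OF assms(1) c(1,2) _ c(4) v, of "- y"] c y unfolding Gy by simp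
  then show ?thesis
    using c y unfolding y_def[symmetric] by (simp add: neg)
qed

section \<open>Second moments\<close>

lemma integrable_mult_of_squares:
  fixes f g :: "'a \<Rightarrow> real"
  assumes [measurable]: "f \<in> borel_measurable P" "g \<in> borel_measurable P"
    and "integrable P (\<lambda>\<omega>. (f \<omega>)\<^sup>2)" "integrable P (\<lambda>\<omega>. (g \<omega>)\<^sup>2)"
  shows "integrable P (\<lambda>\<omega>. f \<omega> * g \<omega>)"
proof (rule Bochner_Integration.integrable_bound)
  show "integrable P (\<lambda>\<omega>. (f \<omega>)\<^sup>2 + (g \<omega>)\<^sup>2)"
    using assms by simp
  show "AE \<omega> in P. norm (f \<omega> * g \<omega>) \<le> norm ((f \<omega>)\<^sup>2 + (g \<omega>)\<^sup>2)"
  proof (rule AE_I2)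
    fix \<omega>
    have "2 * (\<bar>f \<omega>\<bar> * \<bar>g \<omega>\<bar>) \<le> (f \<omega>)\<^sup>2 + (g \<omega>)\<^sup>2"
      using sum_squares_bound[of "\<bar>f \<omega>\<bar>" "\<bar>g \<omega>\<bar>"] by simp
    moreover have "0 \<le> \<bar>f \<omega>\<bar> * \<bar>g \<omega>\<bar>" by simp
    ultimately have "\<bar>f \<omega> * g \<omega>\<bar> \<le> (f \<omega>)\<^sup>2 + (g \<omega>)\<^sup>2"
      unfolding abs_mult by linarith
    then show "norm (f \<omega> * g \<omega>) \<le> norm ((f \<omega>)\<^sup>2 + (g \<omega>)\<^sup>2)"
      by simp
  qed
qed simp

text \<open>Monotonicity of the trace against a positive semidefinite weight, with the second moment
  matrix of \<open>z\<close> replaced by its values in all directions. Writing \<open>Q\<close> as a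
  sum of c c^T reduces the claim to \<open>le\<close>; \<open>int\<close> permits exchanging sum and
  integral.\<close>

lemma expected_quadratic_form_le_trace:
  assumes "psd d Q" "S \<in> carrier_mat d d"
    and z: "\<And>\<omega>. \<omega> \<in> space P \<Longrightarrow> z \<omega> \<in> carrier_vec d"
    and int: "\<And>c. c \<in> carrier_vec d \<Longrightarrow> integrable P (\<lambda>\<omega>. (c \<bullet> z \<omega>)\<^sup>2)"
    and le: "\<And>c. c \<in> carrier_vec d \<Longrightarrow> (\<integral>\<omega>. (c \<bullet> z \<omega>)\<^sup>2 \<partial>P) \<le> c \<bullet> (S *\<^sub>v c)"
  shows "(\<integral>\<omega>. z \<omega> \<bullet> (Q *\<^sub>v z \<omega>) \<partial>P) \<le> mat_trace (Q * S)"
proof -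
  have Q: "Q \<in> carrier_mat d d"
    using assms(1) by (simp add: psd_def)
  obtain c where c: "\<And>l. c l \<in> carrier_vec d"
    and Qc: "\<And>i j. i < d \<Longrightarrow> j < d \<Longrightarrow> Q $$ (i, j) = (\<Sum>l<d. c l $ i * c l $ j)"
    using psd_decomposition[OF assms(1)] by blast
  have "(\<integral>\<omega>. z \<omega> \<bullet> (Q *\<^sub>v z \<omega>) \<partial>P) = (\<integral>\<omega>. (\<Sum>l<d. (c l \<bullet> z \<omega>)\<^sup>2) \<partial>P)"
    by (intro Bochner_Integration.integral_cong refl quadratic_form_decomposition Q c z Qc)
  also have "\<dots> = (\<Sum>l<d. (\<integral>\<omega>. (c l \<bullet> z \<omega>)\<^sup>2 \<partial>P))"
    by (rule Bochner_Integration.integral_sum) (simp add: int c)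
  also have "\<dots> \<le> (\<Sum>l<d. c l \<bullet> (S *\<^sub>v c l))"
    by (intro sum_mono le c)
  also have "\<dots> = mat_trace (Q * S)"
    by (rule mat_trace_decomposition[symmetric]) (use Q assms(2) c Qc in auto)
  finally show ?thesis .
qed

lemma measurable_scalar_prod_vec_borel:
  assumes "a \<in> carrier_vec d"
  shows "(\<lambda>v. a \<bullet> v) \<in> borel_measurable (vec_borel d)"
proof -
  have "(\<lambda>v. \<lambda>i\<in>{..<d}. v $ i) \<in> measurable (vec_borel d) (\<Pi>\<^sub>M i\<in>{..<d}. borel)"
    unfolding vec_borel_def by (rule measurable_vimage_algebra1) (auto simp: space_PiM)
  then have "(\<lambda>v. (\<lambda>i\<in>{..<d}. v $ i) i) \<in> borel_measurable (vec_borel d)" if "i < d" for i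
    by (rule measurable_compose[OF _ measurable_component_singleton]) (use that in auto)
  then have comp: "(\<lambda>v. v $ i) \<in> borel_measurable (vec_borel d)" if "i < d" for i
    using that by force
  have "(\<lambda>v. \<Sum>i<d. a $ i * v $ i) \<in> borel_measurable (vec_borel d)"
    by (intro borel_measurable_sum borel_measurable_times comp) auto
  \<comment> \<open>The scalar product sums over the dimension of its right argument, so it agrees
    with the sum over \<open>i<d\<close> only on the space of \<open>vec_borel d\<close>.\<close>
  then show ?thesis
    by (rule measurable_cong[THEN iffD1, rotated])
      (auto simp: vec_borel_def scalar_prod_def lessThan_atLeast0)
qed

lemma gaussian_vec_moments:
  assumes "prob_space P" "gaussian_vec P d X (0\<^sub>v d) V" and a: "a \<in> carrier_vec d"
  shows "(\<lambda>\<omega>. a \<bullet> X \<omega>) \<in> borel_measurable P"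
    and "integrable P (\<lambda>\<omega>. a \<bullet> X \<omega>)" and "(\<integral>\<omega>. a \<bullet> X \<omega> \<partial>P) = 0"
    and "integrable P (\<lambda>\<omega>. (a \<bullet> X \<omega>)\<^sup>2)"
    and "(\<integral>\<omega>. (a \<bullet> X \<omega>)\<^sup>2 \<partial>P) = a \<bullet> (V *\<^sub>v a)"
proof -
  interpret prob_space P by fact
  define v where "v = a \<bullet> (V *\<^sub>v a)"
  have X: "X \<in> measurable P (vec_borel d)" and "psd d V"
    and dist: "if v = 0 then (AE \<omega> in P. a \<bullet> X \<omega> = 0)
      else distributed P lborel (\<lambda>\<omega>. a \<bullet> X \<omega>) (normal_density 0 (sqrt v))"
    using assms(2) a by (auto simp: gaussian_vec_def v_def Let_def)
  have "0 \<le> v"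
    using \<open>psd d V\<close> a by (simp add: psd_def v_def)
  show meas[measurable]: "(\<lambda>\<omega>. a \<bullet> X \<omega>) \<in> borel_measurable P"
    by (rule measurable_compose[OF X measurable_scalar_prod_vec_borel[OF a]])
  have "integrable P (\<lambda>\<omega>. a \<bullet> X \<omega>) \<and> (\<integral>\<omega>. a \<bullet> X \<omega> \<partial>P) = 0 \<and>
      integrable P (\<lambda>\<omega>. (a \<bullet> X \<omega>)\<^sup>2) \<and> (\<integral>\<omega>. (a \<bullet> X \<omega>)\<^sup>2 \<partial>P) = v"
  \<comment> \<open>The degenerate case has no density: the functional is almost surely 0 and so are
    its moments. Otherwise they are those of the normal density; as the mean is 0, the variance is
    the second moment.\<close>
  proof (cases "v = 0")
    case True
    then have ae: "AE \<omega> in P. a \<bullet> X \<omega> = 0" using dist by simp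
    then have ae2: "AE \<omega> in P. (a \<bullet> X \<omega>)\<^sup>2 = 0" by auto
    have "integrable P (\<lambda>\<omega>. a \<bullet> X \<omega>) = integrable P (\<lambda>\<omega>. 0 :: real)"
      by (rule integrable_cong_AE) (use ae in simp_all)
    moreover have "integrable P (\<lambda>\<omega>. (a \<bullet> X \<omega>)\<^sup>2) = integrable P (\<lambda>\<omega>. 0 :: real)"
      by (rule integrable_cong_AE) (use ae2 in simp_all)
    moreover have "(\<integral>\<omega>. a \<bullet> X \<omega> \<partial>P) = 0" "(\<integral>\<omega>. (a \<bullet> X \<omega>)\<^sup>2 \<partial>P) = 0"
      using ae ae2 by (auto intro: integral_eq_zero_AE)
    ultimately show ?thesis using True by simp
  next
    case False
    then have pos: "0 < sqrt v" using \<open>0 \<le> v\<close> by simp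
    have D: "distributed P lborel (\<lambda>\<omega>. a \<bullet> X \<omega>) (normal_density 0 (sqrt v))"
      using dist False by simp
    have "integrable P (\<lambda>\<omega>. a \<bullet> X \<omega>)"
      using distributed_integrable[OF D, of "\<lambda>x. x"] integrable_normal_moment_nz_1[OF pos, of 0]
      by simp
    moreover have "integrable P (\<lambda>\<omega>. (a \<bullet> X \<omega>)\<^sup>2)"
      using distributed_integrable[OF D, of "\<lambda>x. x\<^sup>2"] integrable_normal_moment[OF pos, of 0 2]
      by simp
    moreover have mean: "(\<integral>\<omega>. a \<bullet> X \<omega> \<partial>P) = 0"
      by (rule normal_distributed_expectation[OF pos D])
    moreover have "(\<integral>\<omega>. (a \<bullet> X \<omega>)\<^sup>2 \<partial>P) = v"
      using normal_distributed_variance[OF pos D] mean \<open>0 \<le> v\<close> by simp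
    ultimately show ?thesis by simp
  qed
  then show "integrable P (\<lambda>\<omega>. a \<bullet> X \<omega>)" "(\<integral>\<omega>. a \<bullet> X \<omega> \<partial>P) = 0"
    "integrable P (\<lambda>\<omega>. (a \<bullet> X \<omega>)\<^sup>2)" "(\<integral>\<omega>. (a \<bullet> X \<omega>)\<^sup>2 \<partial>P) = a \<bullet> (V *\<^sub>v a)"
    by (auto simp: v_def)
qed

text \<open>The expectation of the product factors, and both factors are 0. Pairwise independence
  comes from restricting the family to the disjoint index sets \<open>{i}\<close> and
  \<open>{j}\<close>; this places the vectors in one-component product spaces, from which the
  functionals read them off.\<close>

lemma independent_gaussian_uncorrelated:
  assumes "prob_space P" "prob_space.indep_vars P (\<lambda>_. vec_borel d) Z UNIV"
    and "gaussian_vec P d (Z i) (0\<^sub>v d) V" "gaussian_vec P d (Z j) (0\<^sub>v d) V'" "i \<noteq> j"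
    and a: "a \<in> carrier_vec d" and b: "b \<in> carrier_vec d"
  shows "(\<integral>\<omega>. (a \<bullet> Z i \<omega>) * (b \<bullet> Z j \<omega>) \<partial>P) = 0"
proof -
  interpret prob_space P by fact
  have "indep_var (Pi\<^sub>M {i} (\<lambda>_. vec_borel d)) (\<lambda>\<omega>. restrict (\<lambda>l. Z l \<omega>) {i})
      (Pi\<^sub>M {j} (\<lambda>_. vec_borel d)) (\<lambda>\<omega>. restrict (\<lambda>l. Z l \<omega>) {j})"
    by (rule indep_var_restrict[OF assms(2)]) (use assms(5) in auto)
  moreover have "(\<lambda>f. c \<bullet> f l) \<in> borel_measurable (Pi\<^sub>M {l} (\<lambda>_. vec_borel d))"
    if "c \<in> carrier_vec d" for c l
  proof -
    have "(\<lambda>f. f l) \<in> measurable (Pi\<^sub>M {l} (\<lambda>_. vec_borel d)) (vec_borel d)"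
      by (rule measurable_component_singleton) simp
    from measurable_compose[OF this measurable_scalar_prod_vec_borel[OF that]] show ?thesis .
  qed
  ultimately have "indep_var borel ((\<lambda>f. a \<bullet> f i) \<circ> (\<lambda>\<omega>. restrict (\<lambda>l. Z l \<omega>) {i}))
      borel ((\<lambda>f. b \<bullet> f j) \<circ> (\<lambda>\<omega>. restrict (\<lambda>l. Z l \<omega>) {j}))"
    using a b by (intro indep_var_compose) auto
  then have "indep_var borel (\<lambda>\<omega>. a \<bullet> Z i \<omega>) borel (\<lambda>\<omega>. b \<bullet> Z j \<omega>)"
    by (simp add: comp_def)
  then show ?thesis
    using gaussian_vec_moments[OF assms(1,3) a] gaussian_vec_moments[OF assms(1,4) b]
    by (simp add: indep_var_lebesgue_integral)
qed

section \<open>The closed loop\<close>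

lemma closed_loop_carrier:
  assumes "lqg_dynamics P m N A B x0 w x u" "lqg_noise P n Wf W x0 w"
    and "A \<in> carrier_mat n n" "B \<in> carrier_mat n m" "k \<le> N" "\<omega> \<in> space P"
  shows "x k \<omega> \<in> carrier_vec n"
proof -
  have "x0 \<in> measurable P (vec_borel n)" "\<And>j. w j \<in> measurable P (vec_borel n)"
    using assms(2) by (auto simp: lqg_noise_def gaussian_vec_def)
  then have "x0 \<omega> \<in> carrier_vec n" "\<And>j. w j \<omega> \<in> carrier_vec n"
    using assms(6) measurable_space[of _ P "vec_borel n" \<omega>] by (auto simp: vec_borel_def)
  \<comment> \<open>A case distinction suffices: a sum of vectors has the dimension of its last
    summand, which in the dynamics is the noise.\<close>
  then show ?thesis
    using assms(1,5,6) by (cases k) (auto simp: lqg_dynamics_def intro!: carrier_vecI)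
qed

text \<open>Transposition moves the dynamics from the state to the test vector: the new functional
  is (A + B F)^T c, so linear functionals of the state remain linear functionals.\<close>

lemma closed_loop_step:
  assumes "lqg_dynamics P m N A B x0 w x u" "lqg_noise P n Wf W x0 w"
    and A: "A \<in> carrier_mat n n" and B: "B \<in> carrier_mat n m" and F: "F \<in> carrier_mat m n"
    and "k < N" "\<omega> \<in> space P" "u k \<omega> = F *\<^sub>v x k \<omega>" and c: "c \<in> carrier_vec n"
  shows "c \<bullet> x (Suc k) \<omega> = (A\<^sup>T *\<^sub>v c + F\<^sup>T *\<^sub>v (B\<^sup>T *\<^sub>v c)) \<bullet> x k \<omega> + c \<bullet> w k \<omega>"
proof -
  have x: "x k \<omega> \<in> carrier_vec n"
    using closed_loop_carrier[OF assms(1,2) A B] assms(6,7) by simp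
  have "w k \<in> measurable P (vec_borel n)"
    using assms(2) by (auto simp: lqg_noise_def gaussian_vec_def)
  then have w: "w k \<omega> \<in> carrier_vec n"
    using assms(7) measurable_space[of _ P "vec_borel n" \<omega>] by (auto simp: vec_borel_def)
  have "c \<bullet> x (Suc k) \<omega> = c \<bullet> (A *\<^sub>v x k \<omega> + B *\<^sub>v (F *\<^sub>v x k \<omega>) + w k \<omega>)"
    using assms(1,6,7,8) by (simp add: lqg_dynamics_def)
  also have "\<dots> = c \<bullet> (A *\<^sub>v x k \<omega> + B *\<^sub>v (F *\<^sub>v x k \<omega>)) + c \<bullet> w k \<omega>"
    by (rule scalar_prod_add_distrib) (use A B F c x w in auto)
  also have "c \<bullet> (A *\<^sub>v x k \<omega> + B *\<^sub>v (F *\<^sub>v x k \<omega>))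
      = c \<bullet> (A *\<^sub>v x k \<omega>) + c \<bullet> (B *\<^sub>v (F *\<^sub>v x k \<omega>))"
    by (rule scalar_prod_add_distrib) (use A B F c x in auto)
  also have "c \<bullet> (A *\<^sub>v x k \<omega>) = (A\<^sup>T *\<^sub>v c) \<bullet> x k \<omega>"
    using transpose_vec_mult_scalar[OF A x c] by simp
  also have "c \<bullet> (B *\<^sub>v (F *\<^sub>v x k \<omega>)) = (F\<^sup>T *\<^sub>v (B\<^sup>T *\<^sub>v c)) \<bullet> x k \<omega>"
    using transpose_vec_mult_scalar[OF B, of "F *\<^sub>v x k \<omega>" c]
      transpose_vec_mult_scalar[OF F x, of "B\<^sup>T *\<^sub>v c"] A B F c x by simp
  also have "(A\<^sup>T *\<^sub>v c) \<bullet> x k \<omega> + (F\<^sup>T *\<^sub>v (B\<^sup>T *\<^sub>v c)) \<bullet> x k \<omega>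
      = (A\<^sup>T *\<^sub>v c + F\<^sup>T *\<^sub>v (B\<^sup>T *\<^sub>v c)) \<bullet> x k \<omega>"
    by (rule add_scalar_prod_distrib[symmetric]) (use A B F c x in auto)
  finally show ?thesis .
qed

text \<open>x(k) is a linear function of x(0) and w(0), ..., w(k-1), hence uncorrelated with w(j)
  for j >= k. Carrying the correlations themselves through the induction avoids proving that x(k) is
  independent of the later noise. The three claims go together: the first two make the mixed
  products integrable.\<close>

lemma closed_loop_moments:
  assumes dyn: "lqg_dynamics P m N A B x0 w x u" and noise: "lqg_noise P n Wf W x0 w"
    and A: "A \<in> carrier_mat n n" and B: "B \<in> carrier_mat n m"
    and F: "\<And>k. k < N \<Longrightarrow> F k \<in> carrier_mat m n"
    and u: "\<And>k \<omega>. k < N \<Longrightarrow> \<omega> \<in> space P \<Longrightarrow> u k \<omega> = F k *\<^sub>v x k \<omega>"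
    and "k \<le> N" "c \<in> carrier_vec n"
  shows "(\<lambda>\<omega>. c \<bullet> x k \<omega>) \<in> borel_measurable P" (is "?M c k")
    and "integrable P (\<lambda>\<omega>. (c \<bullet> x k \<omega>)\<^sup>2)" (is "?I c k")
    and "\<And>b j. b \<in> carrier_vec n \<Longrightarrow> k \<le> j \<Longrightarrow> (\<integral>\<omega>. (c \<bullet> x k \<omega>) * (b \<bullet> w j \<omega>) \<partial>P) = 0"
      (is "\<And>b j. _ \<Longrightarrow> _ \<Longrightarrow> ?C c k b j = 0")
proof -
  define Z where "Z j = (case j of 0 \<Rightarrow> x0 | Suc k \<Rightarrow> w k)" for j
  have P: "prob_space P" and g0: "gaussian_vec P n x0 (0\<^sub>v n) Wf"
    and gw: "\<And>j. gaussian_vec P n (w j) (0\<^sub>v n) W"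
    and ind: "prob_space.indep_vars P (\<lambda>_. vec_borel n) Z UNIV"
    using noise by (simp_all add: lqg_noise_def Z_def[abs_def])
  have Z: "Z 0 = x0" "\<And>j. Z (Suc j) = w j" by (simp_all add: Z_def)
  have "?M c k \<and> ?I c k \<and> (\<forall>b\<in>carrier_vec n. \<forall>j\<ge>k. ?C c k b j = 0)"
    using \<open>k \<le> N\<close> \<open>c \<in> carrier_vec n\<close>
  proof (induction k arbitrary: c)
    case 0
    have x0: "x 0 \<omega> = x0 \<omega>" if "\<omega> \<in> space P" for \<omega>
      using dyn that by (simp add: lqg_dynamics_def)
    have "?C c 0 b j = 0" if b: "b \<in> carrier_vec n" for b j
    proof -
      have "?C c 0 b j = (\<integral>\<omega>. (c \<bullet> Z 0 \<omega>) * (b \<bullet> Z (Suc j) \<omega>) \<partial>P)"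
        by (rule Bochner_Integration.integral_cong) (simp_all add: x0 Z)
      also have "\<dots> = 0"
        by (rule independent_gaussian_uncorrelated[OF P ind]) (use g0 gw Z 0 b in auto)
      finally show ?thesis .
    qed
    moreover have "?M c 0 = ((\<lambda>\<omega>. c \<bullet> x0 \<omega>) \<in> borel_measurable P)"
      by (rule measurable_cong) (simp add: x0)
    moreover have "?I c 0 = integrable P (\<lambda>\<omega>. (c \<bullet> x0 \<omega>)\<^sup>2)"
      by (rule Bochner_Integration.integrable_cong) (simp_all add: x0)
    ultimately show ?case
      using gaussian_vec_moments[OF P g0] 0 by simp
  next
    case (Suc k)
    have k: "k < N" and c: "c \<in> carrier_vec n" using Suc.prems by auto
    define e where "e = A\<^sup>T *\<^sub>v c + (F k)\<^sup>T *\<^sub>v (B\<^sup>T *\<^sub>v c)"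
    have e: "e \<in> carrier_vec n"
      using A B F[OF k] c by (auto simp: e_def)
    have step: "c \<bullet> x (Suc k) \<omega> = e \<bullet> x k \<omega> + c \<bullet> w k \<omega>" if "\<omega> \<in> space P" for \<omega>
      unfolding e_def by (rule closed_loop_step[OF dyn noise A B F[OF k] k that u[OF k that] c])
    have IH: "?M e k" "?I e k" and IHC: "\<And>b j. b \<in> carrier_vec n \<Longrightarrow> k \<le> j \<Longrightarrow> ?C e k b j = 0"
      using Suc.IH[of e] k e by auto
    note gm = gaussian_vec_moments[OF P gw]
    have [measurable]: "(\<lambda>\<omega>. e \<bullet> x k \<omega>) \<in> borel_measurable P"
      "\<And>b j. b \<in> carrier_vec n \<Longrightarrow> (\<lambda>\<omega>. b \<bullet> w j \<omega>) \<in> borel_measurable P"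
      using IH gm by auto
    have "?M c (Suc k) = ((\<lambda>\<omega>. e \<bullet> x k \<omega> + c \<bullet> w k \<omega>) \<in> borel_measurable P)"
      by (rule measurable_cong) (simp add: step)
    then have 1: "?M c (Suc k)" using c by simp
    have "?I c (Suc k) = integrable P (\<lambda>\<omega>. (e \<bullet> x k \<omega> + c \<bullet> w k \<omega>)\<^sup>2)"
      by (rule Bochner_Integration.integrable_cong) (simp_all add: step)
    moreover have "integrable P (\<lambda>\<omega>. (e \<bullet> x k \<omega>)\<^sup>2 + (c \<bullet> w k \<omega>)\<^sup>2
        + 2 * ((e \<bullet> x k \<omega>) * (c \<bullet> w k \<omega>)))"
      using IH gm[OF c] by (intro Bochner_Integration.integrable_add integrable_mult_right
          integrable_mult_of_squares) auto
    ultimately have 2: "?I c (Suc k)" by (simp add: power2_sum mult.assoc)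
    \<comment> \<open>The noise \<open>w k\<close> has now entered the state; it is uncorrelated
      with \<open>w j\<close> because \<open>Suc k \<le> j\<close> makes the two indices
      distinct.\<close>
    have 3: "?C c (Suc k) b j = 0" if b: "b \<in> carrier_vec n" and j: "Suc k \<le> j" for b j
    proof -
      have "?C c (Suc k) b j
          = (\<integral>\<omega>. (e \<bullet> x k \<omega>) * (b \<bullet> w j \<omega>) + (c \<bullet> w k \<omega>) * (b \<bullet> w j \<omega>) \<partial>P)"
        by (rule Bochner_Integration.integral_cong) (simp_all add: step distrib_right)
      also have "\<dots> = ?C e k b j + (\<integral>\<omega>. (c \<bullet> w k \<omega>) * (b \<bullet> w j \<omega>) \<partial>P)"
        using IH gm b c
        by (intro Bochner_Integration.integral_add integrable_mult_of_squares) auto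
      also have "(\<integral>\<omega>. (c \<bullet> w k \<omega>) * (b \<bullet> w j \<omega>) \<partial>P)
          = (\<integral>\<omega>. (c \<bullet> Z (Suc k) \<omega>) * (b \<bullet> Z (Suc j) \<omega>) \<partial>P)"
        by (simp add: Z)
      also have "\<dots> = 0"
        by (rule independent_gaussian_uncorrelated[OF P ind]) (use gw Z c b j in auto)
      finally show ?thesis using IHC[OF b] j by simp
    qed
    from 1 2 3 show ?case by auto
  qed
  then show "?M c k" "?I c k" "\<And>b j. b \<in> carrier_vec n \<Longrightarrow> k \<le> j \<Longrightarrow> ?C c k b j = 0"
    by auto
qed

text \<open>The Lyapunov recursion X(k+1) = (A + B F) X(k) (A + B F)^T + W for the state covariance,
  tested in the direction c. The cross term vanishes by uncorrelatedness.\<close>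

lemma closed_loop_second_moment_Suc:
  assumes dyn: "lqg_dynamics P m N A B x0 w x u" and noise: "lqg_noise P n Wf W x0 w"
    and A: "A \<in> carrier_mat n n" and B: "B \<in> carrier_mat n m"
    and F: "\<And>k. k < N \<Longrightarrow> F k \<in> carrier_mat m n"
    and u: "\<And>k \<omega>. k < N \<Longrightarrow> \<omega> \<in> space P \<Longrightarrow> u k \<omega> = F k *\<^sub>v x k \<omega>"
    and k: "k < N" and c: "c \<in> carrier_vec n"
  shows "(\<integral>\<omega>. (c \<bullet> x (Suc k) \<omega>)\<^sup>2 \<partial>P)
    = (\<integral>\<omega>. ((A\<^sup>T *\<^sub>v c + (F k)\<^sup>T *\<^sub>v (B\<^sup>T *\<^sub>v c)) \<bullet> x k \<omega>)\<^sup>2 \<partial>P) + c \<bullet> (W *\<^sub>v c)"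
proof -
  define e where "e = A\<^sup>T *\<^sub>v c + (F k)\<^sup>T *\<^sub>v (B\<^sup>T *\<^sub>v c)"
  have e: "e \<in> carrier_vec n"
    using A B F[OF k] c by (auto simp: e_def)
  have step: "c \<bullet> x (Suc k) \<omega> = e \<bullet> x k \<omega> + c \<bullet> w k \<omega>" if "\<omega> \<in> space P" for \<omega>
    unfolding e_def by (rule closed_loop_step[OF dyn noise A B F[OF k] k that u[OF k that] c])
  have P: "prob_space P" and gw: "gaussian_vec P n (w k) (0\<^sub>v n) W"
    using noise by (simp_all add: lqg_noise_def)
  note gm = gaussian_vec_moments[OF P gw c]
  have meas: "(\<lambda>\<omega>. e \<bullet> x k \<omega>) \<in> borel_measurable P"
    and sq: "integrable P (\<lambda>\<omega>. (e \<bullet> x k \<omega>)\<^sup>2)"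
    and uncorr: "(\<integral>\<omega>. (e \<bullet> x k \<omega>) * (c \<bullet> w k \<omega>) \<partial>P) = 0"
    by (rule closed_loop_moments[OF dyn noise A B, of F]; use F u k e c in simp)+
  have int: "integrable P (\<lambda>\<omega>. (e \<bullet> x k \<omega>) * (c \<bullet> w k \<omega>))"
    by (rule integrable_mult_of_squares) (use meas sq gm in auto)
  have "(\<integral>\<omega>. (c \<bullet> x (Suc k) \<omega>)\<^sup>2 \<partial>P)
      = (\<integral>\<omega>. (e \<bullet> x k \<omega>)\<^sup>2 + (c \<bullet> w k \<omega>)\<^sup>2 + 2 * ((e \<bullet> x k \<omega>) * (c \<bullet> w k \<omega>)) \<partial>P)"
    by (rule Bochner_Integration.integral_cong) (simp_all add: step power2_sum)
  also have "\<dots> = (\<integral>\<omega>. (e \<bullet> x k \<omega>)\<^sup>2 \<partial>P) + (\<integral>\<omega>. (c \<bullet> w k \<omega>)\<^sup>2 \<partial>P)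
      + 2 * (\<integral>\<omega>. (e \<bullet> x k \<omega>) * (c \<bullet> w k \<omega>) \<partial>P)"
    using sq gm(4) int by simp
  also have "(\<integral>\<omega>. (e \<bullet> x k \<omega>) * (c \<bullet> w k \<omega>) \<partial>P) = 0"
    by (rule uncorr)
  finally show ?thesis
    using gm(5) by (simp add: e_def)
qed

lemma input_scalar_prod:
  fixes F :: "real mat"
  assumes F: "F \<in> carrier_mat m n"
    and a: "a \<in> carrier_vec n" and b: "b \<in> carrier_vec m" and x: "x \<in> carrier_vec n"
  shows "(a @\<^sub>v b) \<bullet> (x @\<^sub>v (F *\<^sub>v x)) = (a + F\<^sup>T *\<^sub>v b) \<bullet> x"
proof -
  have "(a @\<^sub>v b) \<bullet> (x @\<^sub>v (F *\<^sub>v x)) = a \<bullet> x + b \<bullet> (F *\<^sub>v x)"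
    by (rule scalar_prod_append[of _ n _ m]) (use assms in auto)
  also have "b \<bullet> (F *\<^sub>v x) = (F\<^sup>T *\<^sub>v b) \<bullet> x"
    using transpose_vec_mult_scalar[OF F x b] by simp
  also have "a \<bullet> x + (F\<^sup>T *\<^sub>v b) \<bullet> x = (a + F\<^sup>T *\<^sub>v b) \<bullet> x"
    by (rule add_scalar_prod_distrib[symmetric]) (use assms in auto)
  finally show ?thesis .
qed

text \<open>The link between recursion and matrix inequality: for a = A^T c and b = B^T c, the
  vector a + F^T b of \<open>relax_lmi_bound\<close> is (A + B F)^T c, the functional in the
  Lyapunov recursion.\<close>

lemma covariance_bound_quadratic_form:
  assumes A: "A \<in> carrier_mat n n" and B: "B \<in> carrier_mat n m"
    and S: "S \<in> carrier_mat (n + m) (n + m)" and W: "W \<in> carrier_mat n n"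
    and c: "c \<in> carrier_vec n"
  shows "c \<bullet> ((append_columns A B * S * (append_columns A B)\<^sup>T + W) *\<^sub>v c)
    = ((A\<^sup>T *\<^sub>v c) @\<^sub>v (B\<^sup>T *\<^sub>v c)) \<bullet> (S *\<^sub>v ((A\<^sup>T *\<^sub>v c) @\<^sub>v (B\<^sup>T *\<^sub>v c))) + c \<bullet> (W *\<^sub>v c)"
proof -
  let ?H = "append_columns A B"
  have H: "?H \<in> carrier_mat n (n + m)"
    using A B by (rule append_columns_carrier)
  define p where "p = ?H\<^sup>T *\<^sub>v c"
  have p: "p \<in> carrier_vec (n + m)" using H c by (simp add: p_def)
  have "(?H * S * ?H\<^sup>T + W) *\<^sub>v c = (?H * S * ?H\<^sup>T) *\<^sub>v c + W *\<^sub>v c"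
    by (rule add_mult_distrib_mat_vec) (use H S W c in auto)
  also have "(?H * S * ?H\<^sup>T) *\<^sub>v c = (?H * S) *\<^sub>v p"
    unfolding p_def by (rule assoc_mult_mat_vec) (use H S c in auto)
  also have "\<dots> = ?H *\<^sub>v (S *\<^sub>v p)"
    by (rule assoc_mult_mat_vec) (use H S p in auto)
  also have "c \<bullet> (?H *\<^sub>v (S *\<^sub>v p) + W *\<^sub>v c) = c \<bullet> (?H *\<^sub>v (S *\<^sub>v p)) + c \<bullet> (W *\<^sub>v c)"
    by (rule scalar_prod_add_distrib) (use H S W p c in auto)
  also have "c \<bullet> (?H *\<^sub>v (S *\<^sub>v p)) = p \<bullet> (S *\<^sub>v p)"
    using transpose_vec_mult_scalar[OF H, of "S *\<^sub>v p" c] S p c by (simp add: p_def)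
  finally show ?thesis
    using A B c by (simp add: p_def transpose_append_columns_mult_vec)
qed

text \<open>The V_k of the overview as one function, which gives the initial and the later
  inequalities a common form. The value at \<open>k = N\<close>, where no inequality is imposed, is
  the matrix in the terminal cost when \<open>N\<close> is positive.\<close>

definition covariance_bound ::
  "real mat \<Rightarrow> real mat \<Rightarrow> real mat \<Rightarrow> real mat \<Rightarrow> (nat \<Rightarrow> real mat) \<Rightarrow> nat \<Rightarrow> real mat" where
  "covariance_bound A B Wf W S k =
     (if k = 0 then Wf else append_columns A B * S (k - 1) * (append_columns A B)\<^sup>T + W)"

lemma covariance_bound_0 [simp]: "covariance_bound A B Wf W S 0 = Wf"
  by (simp add: covariance_bound_def)

lemma covariance_bound_Suc:
  "covariance_bound A B Wf W S (Suc k)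
    = append_columns A B * S k * (append_columns A B)\<^sup>T + W"
  by (simp add: covariance_bound_def)

lemma covariance_bound_carrier:
  assumes "A \<in> carrier_mat n n" "B \<in> carrier_mat n m"
    and "Wf \<in> carrier_mat n n" "W \<in> carrier_mat n n"
  shows "covariance_bound A B Wf W S k \<in> carrier_mat n n"
  using assms append_columns_carrier[OF assms(1,2)]
  by (auto simp: covariance_bound_def)

text \<open>The matrix inequalities enter only through \<open>bound\<close>, and the trajectory is
  any one driven by the gains \<open>F\<close>.\<close>

context
  fixes P :: "'a measure" and m n N :: nat and A B Q R Wf W :: "real mat"
    and x0 :: "'a \<Rightarrow> real vec" and w x u :: "nat \<Rightarrow> 'a \<Rightarrow> real vec" and F S :: "nat \<Rightarrow> real mat"
  assumes dyn: "lqg_dynamics P m N A B x0 w x u" and noise: "lqg_noise P n Wf W x0 w"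
    and A: "A \<in> carrier_mat n n" and B: "B \<in> carrier_mat n m"
    and F: "\<And>k. k < N \<Longrightarrow> F k \<in> carrier_mat m n"
    and u: "\<And>k \<omega>. k < N \<Longrightarrow> \<omega> \<in> space P \<Longrightarrow> u k \<omega> = F k *\<^sub>v x k \<omega>"
    and S: "\<And>k. k < N \<Longrightarrow> S k \<in> carrier_mat (n + m) (n + m)"
    and bound: "\<And>k a b. k < N \<Longrightarrow> a \<in> carrier_vec n \<Longrightarrow> b \<in> carrier_vec m \<Longrightarrow>
      (a + (F k)\<^sup>T *\<^sub>v b) \<bullet> (covariance_bound A B Wf W S k *\<^sub>v (a + (F k)\<^sup>T *\<^sub>v b))
        \<le> (a @\<^sub>v b) \<bullet> (S k *\<^sub>v (a @\<^sub>v b))"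
begin

lemma noise_covariance_carrier: "Wf \<in> carrier_mat n n" "W \<in> carrier_mat n n"
  using noise by (auto simp: lqg_noise_def gaussian_vec_def psd_def)

text \<open>Equality at time 0. The step chains the Lyapunov recursion, the induction hypothesis at
  (A + B F)^T c, and \<open>bound\<close> at (A^T c, B^T c).\<close>

lemma closed_loop_second_moment_le:
  assumes "k \<le> N" "c \<in> carrier_vec n"
  shows "(\<integral>\<omega>. (c \<bullet> x k \<omega>)\<^sup>2 \<partial>P) \<le> c \<bullet> (covariance_bound A B Wf W S k *\<^sub>v c)"
  using assms
proof (induction k arbitrary: c)
  case 0
  have P: "prob_space P" and g0: "gaussian_vec P n x0 (0\<^sub>v n) Wf"
    using noise by (simp_all add: lqg_noise_def)
  have "(\<integral>\<omega>. (c \<bullet> x 0 \<omega>)\<^sup>2 \<partial>P) = (\<integral>\<omega>. (c \<bullet> x0 \<omega>)\<^sup>2 \<partial>P)"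
    using dyn by (intro Bochner_Integration.integral_cong) (auto simp: lqg_dynamics_def)
  then show ?case
    using gaussian_vec_moments(5)[OF P g0 0(2)] by simp
next
  case (Suc k)
  have k: "k < N" and c: "c \<in> carrier_vec n" using Suc.prems by auto
  let ?a = "A\<^sup>T *\<^sub>v c" and ?b = "B\<^sup>T *\<^sub>v c"
  have ab: "?a \<in> carrier_vec n" "?b \<in> carrier_vec m"
    using A B c by auto
  have e: "?a + (F k)\<^sup>T *\<^sub>v ?b \<in> carrier_vec n"
    using ab F[OF k] by auto
  have "(\<integral>\<omega>. (c \<bullet> x (Suc k) \<omega>)\<^sup>2 \<partial>P)
      = (\<integral>\<omega>. ((?a + (F k)\<^sup>T *\<^sub>v ?b) \<bullet> x k \<omega>)\<^sup>2 \<partial>P) + c \<bullet> (W *\<^sub>v c)"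
    by (rule closed_loop_second_moment_Suc[OF dyn noise A B, of F]) (use F u k c in auto)
  also have "(\<integral>\<omega>. ((?a + (F k)\<^sup>T *\<^sub>v ?b) \<bullet> x k \<omega>)\<^sup>2 \<partial>P)
      \<le> (?a + (F k)\<^sup>T *\<^sub>v ?b) \<bullet> (covariance_bound A B Wf W S k *\<^sub>v (?a + (F k)\<^sup>T *\<^sub>v ?b))"
    using k e by (intro Suc.IH) auto
  also have "\<dots> \<le> (?a @\<^sub>v ?b) \<bullet> (S k *\<^sub>v (?a @\<^sub>v ?b))"
    by (rule bound[OF k ab])
  finally show ?case
    unfolding covariance_bound_Suc
      covariance_bound_quadratic_form[OF A B S[OF k] noise_covariance_carrier(2) c]
    by simp
qed

text \<open>Under the feedback a functional of (x, u) is the functional \<open>e\<close> of x alone,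
  so the state bound followed by \<open>bound\<close> yields the bound by \<open>S k\<close> in
  every direction.\<close>

lemma stage_cost_le:
  assumes "psd n Q" "pos_def m R" and k: "k < N"
  shows "(\<integral>\<omega>. (x k \<omega> @\<^sub>v u k \<omega>) \<bullet> (stage_weight n m Q R *\<^sub>v (x k \<omega> @\<^sub>v u k \<omega>)) \<partial>P)
    \<le> mat_trace (stage_weight n m Q R * S k)"
proof (rule expected_quadratic_form_le_trace[OF psd_stage_weight[OF assms(1,2)] S[OF k]])
  have x: "x k \<omega> \<in> carrier_vec n" if "\<omega> \<in> space P" for \<omega>
    using closed_loop_carrier[OF dyn noise A B _ that] k by simp
  then show "x k \<omega> @\<^sub>v u k \<omega> \<in> carrier_vec (n + m)" if "\<omega> \<in> space P" for \<omega>
    using that u[OF k that] F[OF k] by auto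
  fix c :: "real vec" assume "c \<in> carrier_vec (n + m)"
  then obtain a b where c: "c = a @\<^sub>v b" "a \<in> carrier_vec n" "b \<in> carrier_vec m"
    by (metis vec_first_carrier vec_first_last_append vec_last_carrier)
  define e where "e = a + (F k)\<^sup>T *\<^sub>v b"
  have e: "e \<in> carrier_vec n" using c F[OF k] by (auto simp: e_def)
  have eq: "c \<bullet> (x k \<omega> @\<^sub>v u k \<omega>) = e \<bullet> x k \<omega>" if "\<omega> \<in> space P" for \<omega>
    unfolding c(1) e_def u[OF k that] by (rule input_scalar_prod[OF F[OF k] c(2,3) x[OF that]])
  have "integrable P (\<lambda>\<omega>. (e \<bullet> x k \<omega>)\<^sup>2)"
    by (rule closed_loop_moments[OF dyn noise A B, of F]) (use F u k e in auto)
  moreover have "integrable P (\<lambda>\<omega>. (c \<bullet> (x k \<omega> @\<^sub>v u k \<omega>))\<^sup>2)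
      = integrable P (\<lambda>\<omega>. (e \<bullet> x k \<omega>)\<^sup>2)"
    by (rule Bochner_Integration.integrable_cong) (simp_all add: eq)
  ultimately show "integrable P (\<lambda>\<omega>. (c \<bullet> (x k \<omega> @\<^sub>v u k \<omega>))\<^sup>2)" by simp
  have "(\<integral>\<omega>. (c \<bullet> (x k \<omega> @\<^sub>v u k \<omega>))\<^sup>2 \<partial>P) = (\<integral>\<omega>. (e \<bullet> x k \<omega>)\<^sup>2 \<partial>P)"
    by (rule Bochner_Integration.integral_cong) (simp_all add: eq)
  also have "\<dots> \<le> e \<bullet> (covariance_bound A B Wf W S k *\<^sub>v e)"
    using k e by (intro closed_loop_second_moment_le) auto
  also have "\<dots> \<le> c \<bullet> (S k *\<^sub>v c)"
    unfolding c(1) e_def by (rule bound[OF k c(2,3)])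
  finally show "(\<integral>\<omega>. (c \<bullet> (x k \<omega> @\<^sub>v u k \<omega>))\<^sup>2 \<partial>P) \<le> c \<bullet> (S k *\<^sub>v c)" .
qed

lemma terminal_cost_le:
  assumes "psd n Qf"
  shows "(\<integral>\<omega>. x N \<omega> \<bullet> (Qf *\<^sub>v x N \<omega>) \<partial>P) \<le> mat_trace (Qf * covariance_bound A B Wf W S N)"
proof (rule expected_quadratic_form_le_trace[OF assms])
  show "covariance_bound A B Wf W S N \<in> carrier_mat n n"
    by (rule covariance_bound_carrier[OF A B noise_covariance_carrier])
  show "x N \<omega> \<in> carrier_vec n" if "\<omega> \<in> space P" for \<omega>
    using closed_loop_carrier[OF dyn noise A B order_refl that] .
  show "integrable P (\<lambda>\<omega>. (c \<bullet> x N \<omega>)\<^sup>2)" if "c \<in> carrier_vec n" for c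
    by (rule closed_loop_moments[OF dyn noise A B, of F]) (use F u that in auto)
qed (simp add: closed_loop_second_moment_le)

lemma lqg_cost_le_relax_cost:
  assumes "psd n Qf" "psd n Q" "pos_def m R" "N \<ge> 1"
  shows "lqg_cost P n m N Qf Q R x u \<le> relax_cost n m N A B Qf Q R W S"
proof -
  \<comment> \<open>For \<open>N = 0\<close> the left side would be \<open>Wf\<close> while
    \<open>N - 1\<close> would be truncated to 0; hence \<open>N \<ge> 1\<close>.\<close>
  have "covariance_bound A B Wf W S N
      = append_columns A B * S (N - 1) * (append_columns A B)\<^sup>T + W"
    using assms(4) by (simp add: covariance_bound_def)
  then show ?thesis
    unfolding lqg_cost_def relax_cost_def using terminal_cost_le[OF assms(1)] assms(2,3)
    by (intro add_mono sum_mono stage_cost_le) auto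
qed

end

text \<open>A real \<open>Inf\<close> lies below the members of its set only if the set is bounded
  below; 0 serves as that bound. Integrability is no issue, as the integral of a nonnegative
  function is nonnegative in any case.\<close>

lemma lqg_cost_nonneg:
  assumes dyn: "lqg_dynamics P m N A B x0 w x u" and noise: "lqg_noise P n Wf W x0 w"
    and A: "A \<in> carrier_mat n n" and B: "B \<in> carrier_mat n m"
    and "psd n Qf" "psd n Q" "pos_def m R"
  shows "0 \<le> lqg_cost P n m N Qf Q R x u"
proof -
  have x: "x k \<omega> \<in> carrier_vec n" if "k \<le> N" "\<omega> \<in> space P" for k \<omega>
    by (rule closed_loop_carrier[OF dyn noise A B that])
  have u: "u k \<omega> \<in> carrier_vec m" if "k < N" "\<omega> \<in> space P" for k \<omega>
    using dyn that by (simp add: lqg_dynamics_def)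
  have "0 \<le> (\<integral>\<omega>. (x k \<omega> @\<^sub>v u k \<omega>) \<bullet> (stage_weight n m Q R *\<^sub>v (x k \<omega> @\<^sub>v u k \<omega>)) \<partial>P)"
    if "k < N" for k
  proof (rule integral_nonneg_AE, rule AE_I2)
    fix \<omega> assume "\<omega> \<in> space P"
    then have "x k \<omega> @\<^sub>v u k \<omega> \<in> carrier_vec (n + m)"
      using x[of k \<omega>] u[of k \<omega>] that by simp
    then show "0 \<le> (x k \<omega> @\<^sub>v u k \<omega>) \<bullet> (stage_weight n m Q R *\<^sub>v (x k \<omega> @\<^sub>v u k \<omega>))"
      using psd_stage_weight[OF assms(6,7)] by (simp add: psd_def)
  qed
  moreover have "0 \<le> (\<integral>\<omega>. x N \<omega> \<bullet> (Qf *\<^sub>v x N \<omega>) \<partial>P)"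
    by (rule integral_nonneg_AE, rule AE_I2) (use x assms(5) in \<open>simp add: psd_def\<close>)
  ultimately show ?thesis
    unfolding lqg_cost_def by (intro add_nonneg_nonneg sum_nonneg) auto
qed

lemma lqg_value_le_cost:
  assumes "lqg_noise P n Wf W x0 w" and "n = (\<Sum>i<M. ns i)" "m = (\<Sum>i<M. ms i)"
    and "A \<in> carrier_mat n n" "B \<in> carrier_mat n m"
    and "psd n Qf" "psd n Q" "pos_def m R"
    and "lqg_dynamics P m N A B x0 w x u"
    and "\<And>k. k < N \<Longrightarrow> F k \<in> decentralized_gains M ns ms"
    and "\<And>k \<omega>. k < N \<Longrightarrow> \<omega> \<in> space P \<Longrightarrow> u k \<omega> = F k *\<^sub>v x k \<omega>"
  shows "lqg_value P M ns ms N A B Qf Q R x0 w \<le> lqg_cost P n m N Qf Q R x u"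
  unfolding lqg_value_def assms(2,3)[symmetric]
proof (rule cInf_lower)
  show "lqg_cost P n m N Qf Q R x u \<in> {lqg_cost P n m N Qf Q R x u | x u F.
      lqg_dynamics P m N A B x0 w x u \<and>
      (\<forall>k<N. F k \<in> decentralized_gains M ns ms \<and> (\<forall>\<omega>\<in>space P. u k \<omega> = F k *\<^sub>v x k \<omega>))}"
    using assms(9-11) by blast
  show "bdd_below {lqg_cost P n m N Qf Q R x u | x u F. lqg_dynamics P m N A B x0 w x u \<and>
      (\<forall>k<N. F k \<in> decentralized_gains M ns ms \<and> (\<forall>\<omega>\<in>space P. u k \<omega> = F k *\<^sub>v x k \<omega>))}"
    using lqg_cost_nonneg[OF _ assms(1,4,5,6,7,8)] by (intro bdd_belowI[of _ 0]) auto
qed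

text \<open>The bound on \<open>lqg_value\<close> is not conditional on a given trajectory, so an
  attainable cost has to be exhibited.\<close>

lemma closed_loop_exists:
  assumes "\<And>k. k < N \<Longrightarrow> F k \<in> carrier_mat m n"
  obtains x u where "lqg_dynamics P m N A B x0 w x u" "\<And>k \<omega>. u k \<omega> = F k *\<^sub>v x k \<omega>"
proof -
  define x where "x = rec_nat x0 (\<lambda>k X \<omega>. A *\<^sub>v X \<omega> + B *\<^sub>v (F k *\<^sub>v X \<omega>) + w k \<omega>)"
  have "lqg_dynamics P m N A B x0 w x (\<lambda>k \<omega>. F k *\<^sub>v x k \<omega>)"
    using assms[THEN carrier_matD(1)]
    by (auto simp: lqg_dynamics_def x_def intro!: carrier_vecI)
  then show thesis by (rule that) simp
qed

theorem proposition3: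
  fixes M N n m :: nat and ns ms :: "nat \<Rightarrow> nat"
    and A B Qf Q R Wf W :: "real mat" and Bd :: "nat \<Rightarrow> real mat"
    and P :: "'a measure" and x0 :: "'a \<Rightarrow> real vec" and w :: "nat \<Rightarrow> 'a \<Rightarrow> real vec"
    and S :: "nat \<Rightarrow> real mat" and L G :: "nat \<Rightarrow> nat \<Rightarrow> real mat"
  assumes "M \<ge> 1" and "N \<ge> 1"
    and "n = (\<Sum>i<M. ns i)" and "m = (\<Sum>i<M. ms i)"
    and "A \<in> carrier_mat n n"
    and "\<And>i. i < M \<Longrightarrow> Bd i \<in> carrier_mat (ns i) (ms i)"
    and "B = blkdiag M Bd"
    and "psd n Qf" and "psd n Q" and "pos_def m R"
    and "pos_def n Wf" and "pos_def n W"
    and "lqg_noise P n Wf W x0 w"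
    and "relax_optimal M ns ms N A B Qf Q R Wf W S L G"
  shows "lqg_value P M ns ms N A B Qf Q R x0 w \<le> relax_cost n m N A B Qf Q R W S \<and>
    (\<forall>k<N. \<forall>i<M. invertible_mat (G k i)) \<and>
    (\<forall>x u. lqg_dynamics P m N A B x0 w x u \<and>
       (\<forall>k<N. \<forall>i<M. \<forall>\<omega> \<in> space P.
          vec_block ms i (u k \<omega>)
            = ((L k i)\<^sup>T * (mat_inv (G k i))\<^sup>T) *\<^sub>v vec_block ns i (x k \<omega>)) \<longrightarrow>
       lqg_value P M ns ms N A B Qf Q R x0 w \<le> lqg_cost P n m N Qf Q R x u \<and>
       lqg_cost P n m N Qf Q R x u \<le> relax_cost n m N A B Qf Q R W S)"
proof -
  note A = assms(5) and noise = assms(13)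
  have B: "B \<in> carrier_mat n m"
    unfolding assms(3,4,7) by (rule blkdiag_carrier) (rule assms(6))
  have Wf: "Wf \<in> carrier_mat n n" and W: "W \<in> carrier_mat n n"
    using assms(11,12) by (auto simp: pos_def_def)
  define V where "V = covariance_bound A B Wf W S"
  have V: "V k \<in> carrier_mat n n" for k
    unfolding V_def by (rule covariance_bound_carrier[OF A B Wf W])
  have feas: "relax_feasible M ns ms N A B Wf W S L G"
    using assms(14) by (simp add: relax_optimal_def)
  have S: "S k \<in> carrier_mat (n + m) (n + m)" if "k < N" for k
    using feas that by (simp add: relax_feasible_def Let_def assms(3,4))
  have L: "L k i \<in> carrier_mat (ns i) (ms i)" and G: "G k i \<in> carrier_mat (ns i) (ns i)"
    if "k < N" "i < M" for k i
    using feas that by (simp_all add: relax_feasible_def Let_def)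
  have lmi: "relax_lmi n m (S k) (blkdiag M (G k)) (blkdiag M (L k)) (V k)" if "k < N" for k
    using feas that unfolding V_def covariance_bound_def
    by (cases k) (auto simp: relax_feasible_def Let_def assms(3,4) dest!: bspec[of _ _ k])
  have Ld: "blkdiag M (L k) \<in> carrier_mat n m" and Gd: "blkdiag M (G k) \<in> carrier_mat n n"
    if "k < N" for k
    unfolding assms(3,4) using L[OF that] G[OF that] by (auto intro!: blkdiag_carrier)
  \<comment> \<open>Strictness comes from \<open>Wf\<close> at time 0 and from \<open>W\<close>
    later, where the inequality of the preceding stage makes the other summand nonnegative.\<close>
  have V_pos: "0 < v \<bullet> (V k *\<^sub>v v)" if "k < N" "v \<in> carrier_vec n" "v \<noteq> 0\<^sub>v n" for k v
  proof (cases k)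
    case 0
    then show ?thesis
      using assms(11) that(2,3) by (simp add: V_def pos_def_def)
  next
    case (Suc j)
    then have j: "j < N" using that(1) by simp
    have "(A\<^sup>T *\<^sub>v v) @\<^sub>v (B\<^sup>T *\<^sub>v v) \<in> carrier_vec (n + m)"
      using A B that(2) by auto
    from relax_lmi_psd[OF lmi[OF j] S[OF j] Gd[OF j] Ld[OF j] V this]
    show ?thesis
      using assms(12) that(2,3) unfolding V_def Suc covariance_bound_Suc
        covariance_bound_quadratic_form[OF A B S[OF j] W that(2)]
      by (simp add: pos_def_def add_nonneg_pos)
  qed
  \<comment> \<open>The inequality yields invertibility of the whole block-diagonal matrix, whereas
    the policy inverts single blocks; the determinant is the product of theirs.\<close>
  have det: "det (G k i) \<noteq> 0" if "k < N" "i < M" for k i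
  proof -
    have "det (blkdiag M (G k)) \<noteq> 0"
      using relax_lmi_det[OF lmi S Gd Ld V V_pos] that(1) by simp
    moreover have "det (blkdiag M (G k)) = (\<Prod>i<M. det (G k i))"
      by (rule det_blkdiag) (rule G[OF that(1)])
    ultimately show ?thesis using that(2) by simp
  qed
  define K where "K k i = (L k i)\<^sup>T * (mat_inv (G k i))\<^sup>T" for k i
  define F where "F k = blkdiag M (K k)" for k
  have K: "K k i \<in> carrier_mat (ms i) (ns i)" if "k < N" "i < M" for k i
    using L[OF that] mat_inv_inverts(1)[OF G[OF that] det[OF that]] by (auto simp: K_def)
  have F: "F k \<in> carrier_mat m n" if "k < N" for k
    unfolding F_def assms(3,4) by (rule blkdiag_carrier) (rule K[OF that])
  have F_dec: "F k \<in> decentralized_gains M ns ms" if "k < N" for k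
    unfolding decentralized_gains_def F_def using K[OF that] by blast
  \<comment> \<open>The form of F = L^T G^-T that \<open>relax_lmi_bound\<close> expects, verified
    block by block from G (G^-1 L) = L.\<close>
  have GF: "blkdiag M (G k) * (F k)\<^sup>T = blkdiag M (L k)" if "k < N" for k
  proof -
    have GK: "G k i * (K k i)\<^sup>T = L k i" if i: "i < M" for i
    proof -
      note c = G[OF \<open>k < N\<close> i] L[OF \<open>k < N\<close> i]
      note inv = mat_inv_inverts[OF c(1) det[OF \<open>k < N\<close> i]]
      have "(K k i)\<^sup>T = mat_inv (G k i) * L k i"
        unfolding K_def using c inv by (subst transpose_mult[of _ "ms i" "ns i" _ "ns i"]) auto
      then have "G k i * (K k i)\<^sup>T = (G k i * mat_inv (G k i)) * L k i"
        using c inv(1) by (simp add: assoc_mult_mat[of _ "ns i" "ns i" _ "ns i"])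
      then show ?thesis using c inv by simp
    qed
    have "(F k)\<^sup>T = blkdiag M (\<lambda>i. (K k i)\<^sup>T)"
      unfolding F_def by (rule blkdiag_transpose) (rule K[OF that])
    also have "blkdiag M (G k) * \<dots> = blkdiag M (\<lambda>i. G k i * (K k i)\<^sup>T)"
      by (rule blkdiag_mult[of _ _ ns ns _ ms]) (use G[OF that] K[OF that] in auto)
    also have "\<dots> = blkdiag M (L k)"
      unfolding blkdiag_def by (rule arg_cong[of _ _ diag_block_mat]) (simp add: GK)
    finally show ?thesis .
  qed
  have bound: "(a + (F k)\<^sup>T *\<^sub>v b) \<bullet> (V k *\<^sub>v (a + (F k)\<^sup>T *\<^sub>v b)) \<le> (a @\<^sub>v b) \<bullet> (S k *\<^sub>v (a @\<^sub>v b))"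
    if "k < N" "a \<in> carrier_vec n" "b \<in> carrier_vec m" for k a b
    by (rule relax_lmi_bound[OF _ S[OF that(1)] Gd[OF that(1)] F[OF that(1)] V that(2,3)])
      (use lmi[OF that(1)] in \<open>simp add: GF[OF that(1)]\<close>)
  \<comment> \<open>Stated for arbitrary trajectories because it serves twice: for the constructed
    closed loop and for every loop obeying the policy.\<close>
  have costs: "lqg_value P M ns ms N A B Qf Q R x0 w \<le> lqg_cost P n m N Qf Q R x u"
    "lqg_cost P n m N Qf Q R x u \<le> relax_cost n m N A B Qf Q R W S"
    if dyn: "lqg_dynamics P m N A B x0 w x u"
      and u: "\<And>k \<omega>. k < N \<Longrightarrow> \<omega> \<in> space P \<Longrightarrow> u k \<omega> = F k *\<^sub>v x k \<omega>" for x u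
  proof -
    show "lqg_value P M ns ms N A B Qf Q R x0 w \<le> lqg_cost P n m N Qf Q R x u"
      by (rule lqg_value_le_cost[OF noise assms(3,4) A B assms(8-10) dyn, of F])
        (simp_all add: F_dec u)
    show "lqg_cost P n m N Qf Q R x u \<le> relax_cost n m N A B Qf Q R W S"
      by (rule lqg_cost_le_relax_cost[OF dyn noise A B, of F])
        (use F u S bound assms(2,8-10) in \<open>simp_all add: V_def\<close>)
  qed
  obtain x u where xu: "lqg_dynamics P m N A B x0 w x u" "\<And>k \<omega>. u k \<omega> = F k *\<^sub>v x k \<omega>"
    using closed_loop_exists[of N F m n P A B x0 w] F by blast
  have feedback: "u k \<omega> = F k *\<^sub>v x k \<omega>"
    if dyn: "lqg_dynamics P m N A B x0 w x u"
      and blocks: "\<forall>k<N. \<forall>i<M. \<forall>\<omega> \<in> space P. vec_block ms i (u k \<omega>) = K k i *\<^sub>v vec_block ns i (x k \<omega>)"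
      and k: "k < N" and \<omega>: "\<omega> \<in> space P" for x u k \<omega>
  proof (rule vec_block_eqI[where M = M and ds = ms])
    have x: "x k \<omega> \<in> carrier_vec n"
      using closed_loop_carrier[OF dyn noise A B _ \<omega>] k by simp
    then show "F k *\<^sub>v x k \<omega> \<in> carrier_vec (\<Sum>i<M. ms i)"
      using F[OF k] by (simp flip: assms(4))
    show "u k \<omega> \<in> carrier_vec (\<Sum>i<M. ms i)"
      using dyn k \<omega> by (simp add: lqg_dynamics_def flip: assms(4))
    fix i assume i: "i < M"
    have "vec_block ms i (F k *\<^sub>v x k \<omega>) = K k i *\<^sub>v vec_block ns i (x k \<omega>)"
      unfolding F_def by (rule vec_block_blkdiag_mult) (use K[OF k] x i assms(3) in auto)
    then show "vec_block ms i (u k \<omega>) = vec_block ms i (F k *\<^sub>v x k \<omega>)"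
      using blocks k i \<omega> by simp
  qed
  show ?thesis
  proof (intro conjI allI impI)
    show "lqg_value P M ns ms N A B Qf Q R x0 w \<le> relax_cost n m N A B Qf Q R W S"
      using costs[OF xu(1)] xu(2) by (meson order_trans)
    \<comment> \<open>Makes the policy meaningful, since \<open>mat_inv\<close> is unspecified on
      singular matrices.\<close>
    show "invertible_mat (G k i)" if "k < N" "i < M" for k i
      by (rule invertible_mat_if_det[OF G[OF that] det[OF that]])
  next
    fix x u
    assume "lqg_dynamics P m N A B x0 w x u \<and>
       (\<forall>k<N. \<forall>i<M. \<forall>\<omega> \<in> space P.
          vec_block ms i (u k \<omega>)
            = ((L k i)\<^sup>T * (mat_inv (G k i))\<^sup>T) *\<^sub>v vec_block ns i (x k \<omega>))"
    then have dyn: "lqg_dynamics P m N A B x0 w x u"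
      and blocks: "\<forall>k<N. \<forall>i<M. \<forall>\<omega> \<in> space P. vec_block ms i (u k \<omega>) = K k i *\<^sub>v vec_block ns i (x k \<omega>)"
      by (auto simp: K_def)
    note u = feedback[OF dyn blocks]
    show "lqg_value P M ns ms N A B Qf Q R x0 w \<le> lqg_cost P n m N Qf Q R x u"
      by (rule costs(1)[OF dyn u])
    show "lqg_cost P n m N Qf Q R x u \<le> relax_cost n m N A B Qf Q R W S"
      by (rule costs(2)[OF dyn u])
  qed
qed

end
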